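(* Let $(V,Q)$ be a finite-dimensional non-degenerate quadratic space over a square-dense ordered field $\mathbb{F}$. Assume that $V$ is not negative definite, and let $f\in O_+(V)$ be a positive isometry with $f\neq\mathrm{id}$. If at least one of the following conditions holds: (i) $\mathrm{Mov}(f)$ is positive definite, (ii) $f$ is not an involution and $\mathrm{Mov}(f)$ is not negative semi-definite, then the positive reflection length of $f$ is equal to $\dim\mathrm{Mov}(f)$. Otherwise, it is equal to $\dim\mathrm{Mov}(f)+2$. In particular, every positive isometry is a product of positive reflections.
   Context: An ordered field $\mathbb{F}$ is square-dense if for all $0<a<b$ in $\mathbb{F}$ there is $c\in\mathbb{F}$ with $a<c^2<b$. A quadratic form on a finite-dimensional vector space $V$ over $\mathbb{F}$ is a map $Q\colon V\to\mathbb{F}$ with $Q(av)=a^2Q(v)$ and such that the polar form $\beta(u,v)=Q(u+v)-Q(u)-Q(v)$ is bilinear; $(V,Q)$ is non-degenerate if $\beta$ is. $O(V)$ is the group of $f\in\mathrm{GL}(V)$ with $Q(f(u))=Q(u)$ for all $u$. The moved space of $f\in O(V)$ is $\mathrm{Mov}(f)=\mathrm{im}(\mathrm{id}-f)$. The Wall form of $f$ is the non-degenerate bilinear form $\chi_f$ on $\mathrm{Mov}(f)$ given by $\chi_f(u,v)=\beta(w,v)$, where $w\in V$ is any vector with $u=w-f(w)$. The spinor norm of $f$ is the class $\theta(f)=[\det A]\in\mathbb{F}^\times/(\mathbb{F}^\times)^2$, where $A$ is the matrix of $\chi_f$ in any basis of $\mathrm{Mov}(f)$ (with $\theta(\mathrm{id})=1$);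 it is a group homomorphism. An isometry $f$ is positive if $\theta(f)$ is positive, i.e. $\det A>0$; $O_+(V)$ is the subgroup of positive isometries. A subspace $W$ is positive definite (negative definite) if $Q(v)>0$ ($<0$) for all non-zero $v\in W$, and negative semi-definite if $Q(v)\le0$ for all $v\in W$. A positive reflection is $r_v(u)=u-\frac{\beta(u,v)}{Q(v)}v$ with $v\in V$, $Q(v)>0$. The positive reflection length of $f$ is the minimal $k$ such that $f$ is a product of $k$ positive reflections. An involution is an isometry with $f^2=\mathrm{id}$. *)

theory Defs
  imports
    "HOL-Library.Extended_Nat"
    "Jordan_Normal_Form.Determinant"
begin

class square_dense_field = linordered_field +
  assumes square_dense: "0 < a \<Longrightarrow> a < b \<Longrightarrow> \<exists>c. a < c ^ 2 \<and> c ^ 2 < b"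

definition polar :: "('v::ab_group_add \<Rightarrow> 'a::field) \<Rightarrow> 'v \<Rightarrow> 'v \<Rightarrow> 'a" where
  "polar Q u v = Q (u + v) - Q u - Q v"

text \<open>The vector space is the whole type \<open>'v\<close>, with scalar multiplication \<open>scale\<close>. The set
  \<open>Basis\<close>, inherited from the library locale, is some finite basis; it only witnesses finite
  dimension.\<close>

locale quadratic_space = finite_dimensional_vector_space scale Basis
  for scale :: "'a::field \<Rightarrow> 'v::ab_group_add \<Rightarrow> 'v" and Basis :: "'v set" +
  fixes Q :: "'v \<Rightarrow> 'a"
  assumes Q_scale: "Q (scale a v) = a ^ 2 * Q v"
    and polar_linear_left: "Vector_Spaces.linear scale (*) (\<lambda>u. polar Q u v)"
    and polar_linear_right: "Vector_Spaces.linear scale (*) (\<lambda>v. polar Q u v)"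

locale nondegenerate_quadratic_space = quadratic_space scale Basis Q
  for scale :: "'a::field \<Rightarrow> 'v::ab_group_add \<Rightarrow> 'v" and Basis :: "'v set" and Q :: "'v \<Rightarrow> 'a" +
  assumes nondegenerate: "(\<And>v. polar Q u v = 0) \<Longrightarrow> u = 0"

definition positive_definite :: "('v::ab_group_add \<Rightarrow> 'a::linordered_field) \<Rightarrow> 'v set \<Rightarrow> bool" where
  "positive_definite Q W \<longleftrightarrow> (\<forall>v\<in>W. v \<noteq> 0 \<longrightarrow> Q v > 0)"

definition negative_definite :: "('v::ab_group_add \<Rightarrow> 'a::linordered_field) \<Rightarrow> 'v set \<Rightarrow> bool" where
  "negative_definite Q W \<longleftrightarrow> (\<forall>v\<in>W. v \<noteq> 0 \<longrightarrow> Q v < 0)"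

definition negative_semidefinite :: "('v::ab_group_add \<Rightarrow> 'a::linordered_field) \<Rightarrow> 'v set \<Rightarrow> bool" where
  "negative_semidefinite Q W \<longleftrightarrow> (\<forall>v\<in>W. Q v \<le> 0)"

definition isometries ::
  "('a::field \<Rightarrow> 'v::ab_group_add \<Rightarrow> 'v) \<Rightarrow> ('v \<Rightarrow> 'a) \<Rightarrow> ('v \<Rightarrow> 'v) set" where
  "isometries scale Q = {f. Vector_Spaces.linear scale scale f \<and> bij f \<and> (\<forall>u. Q (f u) = Q u)}"

definition involution :: "('v \<Rightarrow> 'v) \<Rightarrow> bool" where
  "involution f \<longleftrightarrow> f \<circ> f = id"

definition Mov :: "('v::ab_group_add \<Rightarrow> 'v) \<Rightarrow> 'v set" where
  "Mov f = range (\<lambda>w. w - f w)"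

text \<open>The Wall form is only meaningful for arguments in \<open>Mov f\<close>. The choice of \<open>w\<close> is
  irrelevant there, see \<open>wall_form_eq\<close> below.\<close>

definition wall_form ::
  "('v::ab_group_add \<Rightarrow> 'a::field) \<Rightarrow> ('v \<Rightarrow> 'v) \<Rightarrow> 'v \<Rightarrow> 'v \<Rightarrow> 'a" where
  "wall_form Q f u v = polar Q (SOME w. u = w - f w) v"

definition ordered_basis ::
  "('a::field \<Rightarrow> 'v::ab_group_add \<Rightarrow> 'v) \<Rightarrow> 'v set \<Rightarrow> 'v list \<Rightarrow> bool" where
  "ordered_basis scale W bs \<longleftrightarrow>
     distinct bs \<and> \<not> module.dependent scale (set bs) \<and> module.span scale (set bs) = W"

definition wall_matrix ::
  "('v::ab_group_add \<Rightarrow> 'a::field) \<Rightarrow> ('v \<Rightarrow> 'v) \<Rightarrow> 'v list \<Rightarrow> 'a mat" where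
  "wall_matrix Q f bs =
     mat (length bs) (length bs) (\<lambda>(i, j). wall_form Q f (bs ! i) (bs ! j))"

text \<open>The coset of \<open>d\<close> modulo non-zero squares.\<close>

definition square_class :: "'a::field \<Rightarrow> 'a set" where
  "square_class d = {d * c ^ 2 | c. c \<noteq> 0}"

text \<open>Changing the basis multiplies the determinant by a non-zero square, so the class does not
  depend on the basis chosen. For \<open>f = id\<close> the matrix is empty, with determinant \<open>1\<close>.\<close>

definition spinor_norm ::
  "('a::field \<Rightarrow> 'v::ab_group_add \<Rightarrow> 'v) \<Rightarrow> ('v \<Rightarrow> 'a) \<Rightarrow> ('v \<Rightarrow> 'v) \<Rightarrow> 'a set" where
  "spinor_norm scale Q f =
     square_class (det (wall_matrix Q f (SOME bs. ordered_basis scale (Mov f) bs)))"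

definition positive_class :: "'a::linordered_field set \<Rightarrow> bool" where
  "positive_class C \<longleftrightarrow> (\<forall>d\<in>C. d > 0)"

definition positive_isometries ::
  "('a::linordered_field \<Rightarrow> 'v::ab_group_add \<Rightarrow> 'v) \<Rightarrow> ('v \<Rightarrow> 'a) \<Rightarrow> ('v \<Rightarrow> 'v) set" where
  "positive_isometries scale Q = {f \<in> isometries scale Q. positive_class (spinor_norm scale Q f)}"

definition reflection ::
  "('a::field \<Rightarrow> 'v::ab_group_add \<Rightarrow> 'v) \<Rightarrow> ('v \<Rightarrow> 'a) \<Rightarrow> 'v \<Rightarrow> 'v \<Rightarrow> 'v" where
  "reflection scale Q v u = u - scale (polar Q u v / Q v) v"

definition positive_reflections ::
  "('a::linordered_field \<Rightarrow> 'v::ab_group_add \<Rightarrow> 'v) \<Rightarrow> ('v \<Rightarrow> 'a) \<Rightarrow> ('v \<Rightarrow> 'v) set" where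
  "positive_reflections scale Q = {reflection scale Q v | v. Q v > 0}"

definition product_of_positive_reflections ::
  "('a::linordered_field \<Rightarrow> 'v::ab_group_add \<Rightarrow> 'v) \<Rightarrow> ('v \<Rightarrow> 'a) \<Rightarrow> nat \<Rightarrow> ('v \<Rightarrow> 'v) \<Rightarrow> bool" where
  "product_of_positive_reflections scale Q k f \<longleftrightarrow>
     (\<exists>rs. length rs = k \<and> set rs \<subseteq> positive_reflections scale Q \<and> f = foldr (\<circ>) rs id)"

text \<open>The length is \<open>\<infinity>\<close> (the infimum of the empty set) if \<open>f\<close> is not a product of
  positive reflections.\<close>

definition positive_reflection_length ::
  "('a::linordered_field \<Rightarrow> 'v::ab_group_add \<Rightarrow> 'v) \<Rightarrow> ('v \<Rightarrow> 'a) \<Rightarrow> ('v \<Rightarrow> 'v) \<Rightarrow> enat" where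
  "positive_reflection_length scale Q f =
     (INF k \<in> {k. product_of_positive_reflections scale Q k f}. enat k)"

context quadratic_space
begin

lemma polar_diff:
  "polar Q (u - u') v = polar Q u v - polar Q u' v"
  "polar Q u (v - v') = polar Q u v - polar Q u v'"
proof -
  interpret l: Vector_Spaces.linear scale "(*)" "\<lambda>u. polar Q u v" by (rule polar_linear_left)
  interpret r: Vector_Spaces.linear scale "(*)" "\<lambda>v. polar Q u v" by (rule polar_linear_right)
  show "polar Q (u - u') v = polar Q u v - polar Q u' v" by (rule l.diff)
  show "polar Q u (v - v') = polar Q u v - polar Q u v'" by (rule r.diff)
qed

lemma wall_form_eq:
  assumes f: "f \<in> isometries scale Q" and v: "v \<in> Mov f"
  shows "wall_form Q f (w - f w) v = polar Q w v"
proof -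
  interpret f: Vector_Spaces.linear scale scale f using f by (simp add: isometries_def)
  define w' where "w' = (SOME w'. w - f w = w' - f w')"
  have w': "w - f w = w' - f w'" unfolding w'_def by (rule someI) (rule refl)
  have fixed: "f (w' - w) = w' - w"
    using w' by (simp add: f.diff algebra_simps)
  have inv: "polar Q (f x) (f y) = polar Q x y" for x y
    using f unfolding polar_def isometries_def by (simp flip: f.add)
  obtain z where z: "v = z - f z" using v by (auto simp: Mov_def)
  have "polar Q (w' - w) v = polar Q (w' - w) z - polar Q (w' - w) (f z)"
    unfolding z by (rule polar_diff)
  also have "polar Q (w' - w) (f z) = polar Q (w' - w) z"
    using inv[of "w' - w" z] fixed by simp
  finally have "polar Q w' v = polar Q w v" by (simp add: polar_diff)
  then show ?thesis by (simp add: wall_form_def w'_def)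
qed

end

lemma positive_class_square_class:
  "positive_class (square_class d) \<longleftrightarrow> d > (0 :: 'a::linordered_field)"
proof
  assume "positive_class (square_class d)"
  moreover have "d \<in> square_class d" unfolding square_class_def by (auto intro!: exI[of _ 1])
  ultimately show "d > 0" by (simp add: positive_class_def)
next
  assume "d > 0"
  then show "positive_class (square_class d)"
    by (auto simp: positive_class_def square_class_def zero_less_mult_iff)
qed

end

theory Submission
  imports Defs
begin

text \<open>The Wall form \<open>\<chi>\<close> of \<open>f\<close> restricts to the Wall form of \<open>r\<^sub>v f\<close> on
  \<open>{u. \<chi> v u = 0}\<close> whenever \<open>v \<in> Mov f\<close> with \<open>Q v \<noteq> 0\<close>, so a factorization of \<open>f\<close> into
  \<open>dim (Mov f)\<close> positive reflections amounts to a basis in which \<open>\<chi>\<close> is triangular with positive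
  diagonal. As \<open>f\<close> is an involution iff \<open>\<chi>\<close> is symmetric, such a basis of an involution is
  orthogonal and \<open>Mov f\<close> is positive definite. Conversely, if \<open>\<chi>\<close> is not symmetric and takes a
  positive value, one can split off a positive vector keeping both properties as long as the
  dimension is at least 3: if no two positive vectors satisfy \<open>\<chi> v u = 0\<close>, then
  \<open>Q v Q w \<le> \<chi> v w \<chi> w v\<close> for all positive \<open>v\<close>, and letting \<open>Q v\<close> tend to 0, which is where
  square-density enters, forces \<open>\<chi>\<close> to be symmetric. In dimension 2 positivity of the determinant
  finishes the argument. Multiplying by a reflection changes \<open>dim (Mov f)\<close> by exactly one, so in
  the remaining cases the length is at least \<open>dim (Mov f) + 2\<close>; this is attained by first
  multiplying with a positive reflection that increases the moved space and destroys the
  obstruction (preceded, for \<open>f = -id\<close>, by one that decreases it).\<close>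

section \<open>Bilinear forms on a subspace\<close>

lemma quadratic_positive_near_0:
  fixes a b c :: "'a::linordered_field"
  assumes "a > 0"
  obtains t where "t > 0" "a + t * b + t^2 * c > 0"
proof -
  \<comment> \<open>The summand \<open>a\<close> makes \<open>m\<close> positive and yields
    \<open>t \<le> 1\<close>, hence \<open>t^2 \<le> t\<close>, so that both error terms are bounded
    by a multiple of \<open>t\<close>.\<close>
  define m where "m = \<bar>b\<bar> + \<bar>c\<bar> + a"
  have m: "m > 0" using assms by (simp add: m_def add_nonneg_pos)
  define t where "t = a / (2 * m)"
  have t: "t > 0" "t * m = a / 2" using m assms by (simp_all add: t_def)
  have "t \<le> 1" using m assms by (simp add: t_def m_def divide_simps)
  have "\<bar>t * b + t^2 * c\<bar> \<le> t * \<bar>b\<bar> + t^2 * \<bar>c\<bar>"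
    using t by (simp add: abs_triangle_ineq[THEN order_trans] abs_mult)
  also have "t^2 * \<bar>c\<bar> \<le> t * \<bar>c\<bar>"
    using t \<open>t \<le> 1\<close> by (intro mult_right_mono) (simp_all add: power2_eq_square)
  finally have "\<bar>t * b + t^2 * c\<bar> \<le> t * (\<bar>b\<bar> + \<bar>c\<bar>)" by (simp add: algebra_simps)
  also have "\<dots> < t * m" using t assms by (intro mult_strict_left_mono) (simp_all add: m_def)
  finally have "\<bar>t * b + t^2 * c\<bar> < a" using t assms by simp
  then show ?thesis using t that[of t] by linarith
qed

section \<open>Dimensions of subspaces and of kernels of functionals\<close>

context finite_dimensional_vector_space
begin

lemma dim_le_Suc_dim_if_spanned:
  assumes W: "W \<subseteq> span (insert p K)"
  shows "dim W \<le> dim K + 1"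
proof -
  have "dim W \<le> dim (insert p K)" using W by (rule dim_mono)
  also have "\<dots> \<le> dim K + 1" by (simp add: dim_insert)
  finally show ?thesis .
qed

lemma dim_eq_Suc_dim_if_complement:
  assumes K: "subspace K" "K \<subseteq> W" and W: "subspace W" and p: "p \<in> W" "p \<notin> K"
    and decomp: "\<And>x. x \<in> W \<Longrightarrow> \<exists>t. x - scale t p \<in> K"
  shows "dim W = dim K + 1"
proof -
  have "W = span (insert p K)"
  proof
    show "W \<subseteq> span (insert p K)"
      unfolding span_insert using decomp K(1) by (auto simp: span_eq_iff[THEN iffD2])
    show "span (insert p K) \<subseteq> W"
      using assms by (intro span_minimal) auto
  qed
  then have "dim W = dim (insert p K)" by simp
  also have "\<dots> = dim K + 1"
    using p(2) K(1) by (simp add: dim_insert span_eq_iff[THEN iffD2])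
  finally show ?thesis .
qed

text \<open>Once the functional is non-zero at some \<open>p\<close>, subtracting multiples of
  \<open>p\<close> moves all of \<open>W\<close> into its kernel. Linearity is asked only on
  \<open>W\<close>, because the functionals to come are built from a form that is bilinear only
  there.\<close>

lemma dim_kernel_le:
  assumes W: "subspace W"
    and add: "\<And>x y. x \<in> W \<Longrightarrow> y \<in> W \<Longrightarrow> \<phi> (x + y) = \<phi> x + \<phi> y"
    and scale: "\<And>a x. x \<in> W \<Longrightarrow> \<phi> (scale a x) = a * \<phi> x"
  shows "subspace {x \<in> W. \<phi> x = 0}" "dim W \<le> dim {x \<in> W. \<phi> x = 0} + 1"
proof -
  let ?K = "{x \<in> W. \<phi> x = 0}"
  have "\<phi> 0 = 0" using scale[of 0 0] W by (simp add: subspace_0)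
  with W show K: "subspace ?K"
    by (auto simp: subspace_def add scale)
  show "dim W \<le> dim ?K + 1"
  proof (cases "\<exists>p\<in>W. \<phi> p \<noteq> 0")
    case True
    then obtain p where p: "p \<in> W" "\<phi> p \<noteq> 0" by blast
    have "x - scale (\<phi> x / \<phi> p) p \<in> ?K" if "x \<in> W" for x
    proof -
      have "\<phi> (x + scale (- (\<phi> x / \<phi> p)) p) = 0"
        using that p W by (simp add: add scale subspace_scale del: scale_minus_left)
      then show ?thesis using that p W by (simp add: subspace_diff subspace_scale)
    qed
    then have "W \<subseteq> span (insert p ?K)"
      unfolding span_insert using span_base by blast
    then show ?thesis by (rule dim_le_Suc_dim_if_spanned)
  next
    case False
    then have "?K = W" by auto
    then show ?thesis by simp
  qed
qed

lemma dim_positive_obtains_nonzero: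
  assumes "dim W > 0"
  obtains x where "x \<in> W" "x \<noteq> 0"
proof -
  have "\<not> W \<subseteq> {0}"
    by (metis assms dim_eq_0 less_irrefl)
  then show ?thesis using that by blast
qed

text \<open>Two functionals lower the dimension by at most two. This is how dimension at least 3
  enters the splitting argument.\<close>

lemma common_kernel_nonzero:
  assumes W: "subspace W" "dim W \<ge> 3"
    and \<phi>: "\<And>x y. x \<in> W \<Longrightarrow> y \<in> W \<Longrightarrow> \<phi> (x + y) = \<phi> x + \<phi> y"
      "\<And>a x. x \<in> W \<Longrightarrow> \<phi> (scale a x) = a * \<phi> x"
    and \<psi>: "\<And>x y. x \<in> W \<Longrightarrow> y \<in> W \<Longrightarrow> \<psi> (x + y) = \<psi> x + \<psi> y"
      "\<And>a x. x \<in> W \<Longrightarrow> \<psi> (scale a x) = a * \<psi> x"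
  obtains w where "w \<in> W" "w \<noteq> 0" "\<phi> w = 0" "\<psi> w = 0"
proof -
  let ?K = "{x \<in> W. \<phi> x = 0}"
  have K: "subspace ?K" "dim W \<le> dim ?K + 1"
    using dim_kernel_le[OF W(1), of \<phi>] \<phi> by blast+
  have "dim ?K \<le> dim {x \<in> ?K. \<psi> x = 0} + 1"
    by (rule dim_kernel_le[OF K(1)]) (use \<psi> in auto)
  then have "dim {x \<in> ?K. \<psi> x = 0} > 0" using K(2) W(2) by linarith
  then show ?thesis using that by (elim dim_positive_obtains_nonzero) auto
qed

end

text \<open>The laws are required only on \<open>W\<close>, since the intended form is the Wall
  form, which is meaningful only on \<open>Mov f\<close>. Symmetry is not assumed.\<close>

locale bilinear_form_on = finite_dimensional_vector_space scale Basis
  for scale :: "'a::linordered_field \<Rightarrow> 'v::ab_group_add \<Rightarrow> 'v" and Basis :: "'v set" +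
  fixes W :: "'v set" and B :: "'v \<Rightarrow> 'v \<Rightarrow> 'a"
  assumes subspace_W: "subspace W"
    and add_left: "u \<in> W \<Longrightarrow> u' \<in> W \<Longrightarrow> v \<in> W \<Longrightarrow> B (u + u') v = B u v + B u' v"
    and add_right: "u \<in> W \<Longrightarrow> v \<in> W \<Longrightarrow> v' \<in> W \<Longrightarrow> B u (v + v') = B u v + B u v'"
    and scale_left: "u \<in> W \<Longrightarrow> v \<in> W \<Longrightarrow> B (scale a u) v = a * B u v"
    and scale_right: "u \<in> W \<Longrightarrow> v \<in> W \<Longrightarrow> B u (scale a v) = a * B u v"
begin

lemma W_closed [simp, intro]:
  "0 \<in> W" "u \<in> W \<Longrightarrow> v \<in> W \<Longrightarrow> u + v \<in> W" "u \<in> W \<Longrightarrow> v \<in> W \<Longrightarrow> u - v \<in> W" "u \<in> W \<Longrightarrow> scale a u \<in> W"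
  using subspace_W by (simp_all add: subspace_0 subspace_add subspace_diff subspace_scale)

lemma diff_left: "u \<in> W \<Longrightarrow> u' \<in> W \<Longrightarrow> v \<in> W \<Longrightarrow> B (u - u') v = B u v - B u' v"
  using add_left[of "u - u'" u' v] by simp

lemma diff_right: "u \<in> W \<Longrightarrow> v \<in> W \<Longrightarrow> v' \<in> W \<Longrightarrow> B u (v - v') = B u v - B u v'"
  using add_right[of u "v - v'" v'] by simp

lemmas expand = add_left add_right scale_left scale_right diff_left diff_right

lemma symmetrization_linear:
  assumes "u \<in> W" "x \<in> W"
  shows "y \<in> W \<Longrightarrow> B u (x + y) + B (x + y) u = (B u x + B x u) + (B u y + B y u)"
    and "B u (scale a x) + B (scale a x) u = a * (B u x + B x u)"
  using assms by (simp_all add: add_left add_right scale_left scale_right distrib_left)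

lemma zero [simp]: "u \<in> W \<Longrightarrow> B 0 u = 0" "u \<in> W \<Longrightarrow> B u 0 = 0"
  using scale_left[of u u 0] scale_right[of u u 0] by simp_all

lemma positive_perturbation:
  assumes "p \<in> W" "x \<in> W" "B p p > 0"
  obtains t where "t > 0" "B (p + scale t x) (p + scale t x) > 0"
proof -
  obtain t where "t > 0" "B p p + t * (B p x + B x p) + t^2 * B x x > 0"
    using quadratic_positive_near_0[OF assms(3)] by blast
  with assms that[of t] show ?thesis
    by (simp add: expand algebra_simps power2_eq_square)
qed

text \<open>The side matters because \<open>B\<close> need not be symmetric: for the Wall form of
  \<open>f\<close> it is this complement, with \<open>v\<close> in the left slot, that becomes the
  moved space of \<open>reflection scale Q v \<circ> f\<close> when \<open>v \<in> Mov f\<close> and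
  \<open>Q v \<noteq> 0\<close>.\<close>

definition orth :: "'v \<Rightarrow> 'v set" where
  "orth v = {u \<in> W. B v u = 0}"

lemma orth_subset: "orth v \<subseteq> W" by (auto simp: orth_def)

lemma subspace_orth: "v \<in> W \<Longrightarrow> subspace (orth v)"
  unfolding orth_def by (rule dim_kernel_le[OF subspace_W]) (simp_all add: expand)

lemma orth_decomposition:
  assumes "v \<in> W" "B v v \<noteq> 0" "x \<in> W"
  shows "x - scale (B v x / B v v) v \<in> orth v"
  using assms by (simp add: orth_def expand)

lemma dim_orth:
  assumes "v \<in> W" "B v v \<noteq> 0"
  shows "dim W = dim (orth v) + 1"
  using assms orth_decomposition[OF assms]
  by (intro dim_eq_Suc_dim_if_complement[OF subspace_orth orth_subset subspace_W, of _ v]) (auto simp: orth_def)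

definition symmetric_on :: "'v set \<Rightarrow> bool" where
  "symmetric_on K \<longleftrightarrow> (\<forall>u\<in>K. \<forall>v\<in>K. B u v = B v u)"

text \<open>The hypothesis \<open>none\<close> says that each \<open>orth v\<close> with \<open>B v v > 0\<close> is negative semidefinite;
  evaluated at the projection of \<open>w\<close> this is the inequality below.\<close>

lemma reverse_Cauchy_Schwarz:
  assumes none: "\<forall>v\<in>W. \<forall>u\<in>W. B v v > 0 \<longrightarrow> B u u > 0 \<longrightarrow> B v u \<noteq> 0"
    and v: "v \<in> W" "B v v > 0" and w: "w \<in> W"
  shows "B v v * B w w \<le> B v w * B w v"
proof -
  define u where "u = w - scale (B v w / B v v) v"
  have u: "u \<in> orth v" using orth_decomposition[of v w] v w by (simp add: u_def)
  then have "B u u \<le> 0" using none v by (force simp: orth_def)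
  moreover have "B v v * B u u = B v v * B w w - B v w * B w v"
    using v w by (simp add: u_def expand field_simps power2_eq_square)
  ultimately show ?thesis
    using v mult_nonneg_nonpos[of "B v v" "B u u"] by simp
qed

end

section \<open>Splitting off a positive vector from a non-symmetric form\<close>

locale nondegenerate_form_on = bilinear_form_on scale Basis W B
  for scale :: "'a::square_dense_field \<Rightarrow> 'v::ab_group_add \<Rightarrow> 'v" and Basis W B +
  assumes nondegenerate_left: "x \<in> W \<Longrightarrow> (\<And>y. y \<in> W \<Longrightarrow> B x y = 0) \<Longrightarrow> x = 0"
    and nondegenerate_right: "y \<in> W \<Longrightarrow> (\<And>x. x \<in> W \<Longrightarrow> B x y = 0) \<Longrightarrow> y = 0"
begin

text \<open>Positivity is an open condition: \<open>p\<close> and \<open>p + scale t x\<close> are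
  both positive for some \<open>t > 0\<close>, so the slope \<open>\<phi> x\<close> between them is
  zero. Linear identities thus need checking at positive vectors only.\<close>

lemma all_if_all_positive:
  assumes p: "p \<in> W" "B p p > 0"
    and pos: "\<And>v. v \<in> W \<Longrightarrow> B v v > 0 \<Longrightarrow> \<phi> v = (0::'a)"
    and lin: "\<And>t x. x \<in> W \<Longrightarrow> \<phi> (p + scale t x) = \<phi> p + t * \<phi> x"
    and x: "x \<in> W"
  shows "\<phi> x = 0"
proof -
  obtain t where t: "t > 0" "B (p + scale t x) (p + scale t x) > 0"
    using positive_perturbation p x by blast
  then have "\<phi> (p + scale t x) = 0" using p x by (intro pos) auto
  with t show ?thesis using pos[OF p] lin[OF x, of t] by simp
qed

text \<open>By contradiction, using orthogonality for the symmetrization of \<open>B\<close>. If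
  \<open>B v w + B w v = 0\<close>, then the right side of the reverse Cauchy-Schwarz inequality is
  \<open>- (B v w)^2\<close>, so the inequality bounds a square from above.\<close>

lemma positive_orthogonal_pair:
  assumes dim: "dim W \<ge> 3" and p: "p \<in> W" "B p p > 0" and "\<not> symmetric_on W"
  obtains v u where "v \<in> W" "u \<in> W" "B v v > 0" "B u u > 0" "B v u = 0"
proof (rule ccontr)
  assume "\<not> thesis"
  then have none: "\<forall>v\<in>W. \<forall>u\<in>W. B v v > 0 \<longrightarrow> B u u > 0 \<longrightarrow> B v u \<noteq> 0"
    using that by blast
  note rcs = reverse_Cauchy_Schwarz[OF none]
  \<comment> \<open>For \<open>r\<close> in the radical of the symmetrization the inequality reads
    \<open>0 \<le> - (B v r)^2\<close>, so \<open>B v r\<close> vanishes for positive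
    \<open>v\<close>, and hence for all \<open>v\<close>.\<close>
  have sym_radical: "r = 0" if r: "r \<in> W" "\<And>x. x \<in> W \<Longrightarrow> B r x + B x r = 0" for r
  proof (rule nondegenerate_right[OF r(1)])
    have "B v r = 0" if "v \<in> W" "B v v > 0" for v
    proof -
      have "B r r = 0" "B r v = - B v r" using r(2)[of r] r(2)[of v] r(1) that
        by (simp_all add: eq_neg_iff_add_eq_0)
      then have "B v r * B v r \<le> 0" using rcs[OF that r(1)] by simp
      then show ?thesis by (auto simp: mult_le_0_iff)
    qed
    then show "B x r = 0" if "x \<in> W" for x
      using all_if_all_positive[of p "\<lambda>v. B v r" x] p r(1) that by (simp add: expand)
  qed
  \<comment> \<open>As in Lorentzian signature, the symmetric complement of a positive vector is
    negative definite. An isotropic vector there would lie in the radical of the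
    symmetrization.\<close>
  have negative: "B w w < 0"
    if v: "v \<in> W" "B v v > 0" and w: "w \<in> W" "w \<noteq> 0" "B v w + B w v = 0" for v w
  proof -
    have le: "B y y \<le> 0" if "y \<in> W" "B v y + B y v = 0" for y
    proof -
      have "B y v = - B v y" using that by (simp add: eq_neg_iff_add_eq_0 add.commute)
      then have "B v v * B y y \<le> - (B v y * B v y)" using rcs[OF v that(1)] by simp
      also have "\<dots> \<le> 0" by simp
      finally show ?thesis using v by (simp add: mult_le_0_iff)
    qed
    have "B w w \<noteq> 0"
    proof
      assume 0: "B w w = 0"
      have "B w x + B x w = 0" if x: "x \<in> W" for x
      proof (rule ccontr)
        define s where "s = B w x + B x w"
        assume "\<not> ?thesis"
        then have "s \<noteq> 0" by (simp add: s_def)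
        define c where "c = (B v x + B x v) / (2 * B v v)"
        define x' where "x' = x - scale c v"
        have "B w x' + B x' w = s - c * (B v w + B w v)"
          using v(1) w(1) x by (simp add: x'_def s_def expand algebra_simps)
        then have x'w: "B w x' + B x' w = s" unfolding w(3) by simp
        have x': "x' \<in> W" "B v x' + B x' v = 0"
          using v x by (auto simp: x'_def c_def expand field_simps)
        \<comment> \<open>Since \<open>w\<close> is isotropic, moving \<open>x'\<close> along
          \<open>w\<close> changes the value linearly with slope \<open>s\<close>; this
          \<open>t\<close> makes it 1.\<close>
        define t where "t = (1 - B x' x') / s"
        have "B v (x' + scale t w) + B (x' + scale t w) v = (B v x' + B x' v) + t * (B v w + B w v)"
          using v(1) w(1) x'(1) by (simp add: expand algebra_simps)
        also have "\<dots> = 0" unfolding w(3) x'(2) by simp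
        finally have "B (x' + scale t w) (x' + scale t w) \<le> 0"
          using le[of "x' + scale t w"] w(1) x'(1) by simp
        moreover have "B (x' + scale t w) (x' + scale t w) = B x' x' + t * (B w x' + B x' w)"
          using w x' 0 by (simp add: expand algebra_simps)
        ultimately show False using \<open>s \<noteq> 0\<close> x'w by (simp add: t_def)
      qed
      then show False using sym_radical w by blast
    qed
    with le[OF w(1,3)] show ?thesis by simp
  qed
  \<comment> \<open>Moving \<open>v\<close> along \<open>w\<close> in either direction brings its
    value close to 0, and the inequality then bounds the pairing with \<open>w'\<close> by a
    quantity smaller than \<open>e\<close>.\<close>
  have orthogonal: "B v w' = 0"
    if v: "v \<in> W" "B v v > 0" and w: "w \<in> W" "w \<noteq> 0" "B v w + B w v = 0"
      and w': "w' \<in> W" "w' \<noteq> 0" "B v w' + B w' v = 0" "B w w' + B w' w = 0" for v w w'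
  proof (rule ccontr)
    assume ne: "B v w' \<noteq> 0"
    define e m n where "e = (B v w')^2" and "m = - B w w" and "n = - B w' w'"
    have pos: "e > 0" "m > 0" "n > 0" using negative[OF v w] negative[OF v w'(1-3)] ne
      by (simp_all add: e_def m_def n_def)
    \<comment> \<open>The first bound keeps \<open>a\<close> positive, as
      \<open>square_dense\<close> demands; the second ensures
      \<open>(B v v - t^2 * m) * n < e\<close>.\<close>
    define a where "a = max (B v v / (2 * m)) ((B v v - e / n) / m)"
    have "0 < a" using pos v by (simp add: a_def less_max_iff_disj)
    moreover have "a < B v v / m" using pos v by (simp add: a_def field_simps)
    ultimately obtain t where "a < t^2" "t^2 < B v v / m" using square_dense by blast
    then have t: "B v v - t^2 * m > 0" "(B v v - t^2 * m) * n < e"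
      using pos by (auto simp: a_def field_simps)
    have "(B v w' + s * B w w')^2 \<le> (B v v - t^2 * m) * n" if "s^2 = t^2" for s
    proof -
      define z where "z = v + scale s w"
      have "B z z = B v v + s * (B v w + B w v) + s^2 * B w w"
        using v(1) w(1) by (simp add: z_def expand algebra_simps power2_eq_square)
      also have "\<dots> = B v v - t^2 * m" unfolding w(3) that by (simp add: m_def)
      finally have z: "z \<in> W" "B z z = B v v - t^2 * m"
        using v(1) w(1) by (simp_all add: z_def)
      have zw': "B z w' = B v w' + s * B w w'" using v w w' by (simp add: z_def expand)
      have "B w' z = - B z w'"
      proof -
        have "B w' z + B z w' = (B v w' + B w' v) + s * (B w w' + B w' w)"
          using v(1) w(1) w'(1) by (simp add: z_def expand algebra_simps)
        also have "\<dots> = 0" unfolding w'(3,4) by simp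
        finally show ?thesis by (simp add: eq_neg_iff_add_eq_0)
      qed
      then have "(B z w')^2 = - (B z w' * B w' z)" by (simp add: power2_eq_square)
      also have "\<dots> \<le> - (B z z * B w' w')" using rcs[OF z(1) _ w'(1)] z(2) t(1) by simp
      finally show ?thesis by (simp add: zw' n_def z(2))
    qed
    \<comment> \<open>Adding the two signs cancels the mixed term and leaves at least
      \<open>2 * e\<close> on the left.\<close>
    from this[of t] this[of "- t"]
    have "(B v w' + t * B w w')^2 + (B v w' - t * B w w')^2 \<le> 2 * ((B v v - t^2 * m) * n)" by simp
    moreover have "(B v w' + t * B w w')^2 + (B v w' - t * B w w')^2 = 2 * e + 2 * (t * B w w')^2"
      by (simp add: e_def power2_eq_square algebra_simps)
    ultimately have "2 * e \<le> 2 * ((B v v - t^2 * m) * n)"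
      using zero_le_power2[of "t * B w w'"] by linarith
    with t show False by simp
  qed
  \<comment> \<open>Remove from \<open>x\<close> its component along \<open>v\<close>. In dimension
    at least 3 some \<open>w\<close> is symmetrically orthogonal to both \<open>v\<close> and the
    remainder \<open>y\<close>, so \<open>orthogonal\<close> applies with \<open>y\<close> in the
    role of \<open>w'\<close>.\<close>
  have sym_positive: "B v x - B x v = 0" if v: "v \<in> W" "B v v > 0" and x: "x \<in> W" for v x
  proof -
    define y where "y = x - scale ((B v x + B x v) / (2 * B v v)) v"
    have y: "y \<in> W" "B v y + B y v = 0"
      using v x by (auto simp: y_def expand field_simps)
    have "B v y = 0"
    proof (cases "y = 0")
      case False
      obtain w where "w \<in> W" "w \<noteq> 0" "B v w + B w v = 0" "B y w + B w y = 0"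
        by (rule common_kernel_nonzero[OF subspace_W dim, of "\<lambda>x. B v x + B x v" "\<lambda>x. B y x + B x y"])
          (use v(1) y(1) in \<open>simp_all only: symmetrization_linear\<close>)
      then show ?thesis using orthogonal[OF v, of w y] False y by (simp add: add.commute)
    qed (use v in simp)
    with y(2) have "B v y = B y v" by simp
    with v x show ?thesis by (simp add: y_def expand)
  qed
  have "B x y = B y x" if "x \<in> W" "y \<in> W" for x y
  proof -
    have "B (p + scale t z) y - B y (p + scale t z) = (B p y - B y p) + t * (B z y - B y z)"
      if "z \<in> W" for t z
      using that p(1) \<open>y \<in> W\<close> by (simp add: expand algebra_simps)
    from all_if_all_positive[OF p, of "\<lambda>v. B v y - B y v", OF _ this that(1)]
    show ?thesis using sym_positive that(2) by simp
  qed
  with assms(4) show False by (auto simp: symmetric_on_def)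
qed

text \<open>The functional \<open>\<lambda>k. B k v\<close> on \<open>orth v\<close> measures the asymmetry of \<open>B\<close>. For positive \<open>v'\<close> in
  \<open>orth v\<close> outside its kernel, \<open>orth v'\<close> contains a positive lift of \<open>v'\<close> and is symmetric only if
  this functional is proportional to \<open>B v'\<close>, which happens on a single line of vectors \<open>v'\<close>.\<close>

lemma symmetric_orth_replacement:
  assumes dim: "dim W \<ge> 3" and v: "v \<in> W" "B v v > 0" and u: "u \<in> orth v" "B u u > 0"
    and sym: "symmetric_on (orth v)" and not_sym: "\<not> symmetric_on W"
  obtains v' u' where "v' \<in> W" "B v' v' > 0" "u' \<in> orth v'" "B u' u' > 0" "\<not> symmetric_on (orth v')"
proof (rule ccontr)
  note result = that
  assume contra: "\<not> thesis"
  let ?K = "orth v"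
  have K: "k \<in> W" "B v k = 0" if "k \<in> ?K" for k using that by (auto simp: orth_def)
  have symK: "B k l = B l k" if "k \<in> ?K" "l \<in> ?K" for k l using sym that by (auto simp: symmetric_on_def)
  have subK: "k + scale t l \<in> ?K" if "k \<in> ?K" "l \<in> ?K" for k l t
    using that subspace_orth[OF v(1)] by (simp add: subspace_add subspace_scale)
  have decomp: "\<exists>k\<in>?K. \<exists>t. x = k + scale t v" if "x \<in> W" for x
    using orth_decomposition[of v x] v that by (metis diff_add_cancel less_irrefl)
  have key: "B y v * B v' v' = B v' v * B v' y"
    if v': "v' \<in> ?K" "B v' v' > 0" "B v' v \<noteq> 0" and y: "y \<in> ?K" for v' y
  proof -
    \<comment> \<open>The multiple of \<open>v\<close> is chosen so that
      \<open>B v' (lift z) = 0\<close>. As \<open>lift v'\<close> is positive, \<open>contra\<close>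
      makes \<open>orth v'\<close> symmetric, and comparing \<open>lift y\<close> with
      \<open>lift v'\<close> gives \<open>key\<close>.\<close>
    define lift where "lift z = z - scale (B v' z / B v' v) v" for z
    have lift: "lift z \<in> orth v'" if "z \<in> ?K" for z
      using K[OF that] K[OF v'(1)] v v' by (simp add: lift_def orth_def expand)
    have form: "B (lift z) (lift z') = B z z' - (B v' z' / B v' v) * B z v
        + (B v' z / B v' v) * (B v' z' / B v' v) * B v v"
      if "z \<in> ?K" "z' \<in> ?K" for z z'
      using K[OF that(1)] K[OF that(2)] v by (simp add: lift_def expand algebra_simps)
    have "B (lift v') (lift v') = (B v' v' / B v' v)^2 * B v v"
      using v' by (simp add: form power2_eq_square)
    then have "B (lift v') (lift v') > 0" using v v' by simp
    then have "symmetric_on (orth v')"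
      using contra result[of v' "lift v'"] lift[OF v'(1)] v' K by blast
    then have "B (lift y) (lift v') = B (lift v') (lift y)"
      using lift y v' by (simp add: symmetric_on_def)
    then show ?thesis
      using v'(3) symK[OF y v'(1)] by (simp add: form[OF y v'(1)] form[OF v'(1) y] field_simps)
  qed
  \<comment> \<open>If the functional vanished on \<open>orth v\<close>, the symmetry there would
    extend to all of \<open>W\<close>.\<close>
  have "\<exists>k\<in>?K. B k v \<noteq> 0"
  proof (rule ccontr)
    assume "\<not> ?thesis"
    then have 0: "B k v = 0" if "k \<in> ?K" for k using that by blast
    have "B x y = B y x" if xy: "x \<in> W" "y \<in> W" for x y
    proof -
      obtain a s where x: "a \<in> ?K" "x = a + scale s v" using decomp[OF xy(1)] by blast
      obtain b t where y: "b \<in> ?K" "y = b + scale t v" using decomp[OF xy(2)] by blast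
      show ?thesis using x y K[OF x(1)] K[OF y(1)] v 0[OF x(1)] 0[OF y(1)] symK[OF x(1) y(1)]
        by (simp add: expand)
    qed
    then show False using not_sym by (simp add: symmetric_on_def)
  qed
  then obtain k where k: "k \<in> ?K" "B k v \<noteq> 0" by blast
  obtain v1 where v1: "v1 \<in> ?K" "B v1 v1 > 0" "B v1 v \<noteq> 0"
  proof (cases "B u v = 0")
    case True
    obtain t where "t > 0" "B (u + scale t k) (u + scale t k) > 0"
      using positive_perturbation K u k by blast
    with True show ?thesis using that[of "u + scale t k"] subK[OF u(1) k(1)] K u k v by (simp add: expand)
  qed (use u that in blast)
  \<comment> \<open>This \<open>x\<close> is orthogonal to \<open>v\<close> on both sides, so
    \<open>v1\<close> and \<open>v2 = v1 + scale t x\<close> have the same pairing with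
    \<open>v\<close>. Comparing \<open>key\<close> at the two places \<open>x\<close> in the left
    radical.\<close>
  obtain x where "x \<in> W" "x \<noteq> 0" "B v x = 0" "B x v = 0"
    by (rule common_kernel_nonzero[OF subspace_W dim, of "\<lambda>x. B v x" "\<lambda>x. B x v"])
      (use v(1) in \<open>simp_all add: expand\<close>)
  then have x: "x \<in> ?K" "x \<noteq> 0" "B x v = 0" by (auto simp: orth_def)
  obtain t where t: "t > 0" "B (v1 + scale t x) (v1 + scale t x) > 0"
    using positive_perturbation K v1 x by blast
  define v2 where "v2 = v1 + scale t x"
  have v2v: "B v2 v = B v1 v" using K v1 x v by (simp add: v2_def expand)
  have v2: "v2 \<in> ?K" "B v2 v2 > 0" "B v2 v \<noteq> 0"
    using t v1 x v2v by (auto simp: v2_def subK)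
  have v2y: "B v2 y = B v1 y + t * B x y" if "y \<in> ?K" for y
    using K[OF that] K[OF v1(1)] K[OF x(1)] by (simp add: v2_def expand)
  have v1x: "B v1 x = 0" using key[OF v1 x(1)] x v1 by simp
  have xx: "B x x = 0" using key[OF v2 x(1)] x v2 v2y[OF x(1)] t v1x by simp
  have v22: "B v2 v2 = B v1 v1"
    using K[OF v1(1)] K[OF x(1)] xx v1x symK[OF v1(1) x(1)] by (simp add: v2_def expand)
  have xK: "B x y = 0" if "y \<in> ?K" for y
    using key[OF v1 that] key[OF v2 that] v1 t by (simp add: v22 v2v v2y[OF that])
  have "B x y = 0" if "y \<in> W" for y
  proof -
    obtain b s where y: "b \<in> ?K" "y = b + scale s v" using decomp \<open>y \<in> W\<close> by blast
    then show ?thesis using K[OF y(1)] K[OF x(1)] v x xK[OF y(1)] by (simp add: expand)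
  qed
  with nondegenerate_left x K show False by blast
qed

lemma nonsymmetric_reduction:
  assumes dim: "dim W \<ge> 3" and p: "p \<in> W" "B p p > 0" and not_sym: "\<not> symmetric_on W"
  obtains v u where "v \<in> W" "B v v > 0" "u \<in> orth v" "B u u > 0" "\<not> symmetric_on (orth v)"
proof -
  obtain v u where vu: "v \<in> W" "u \<in> W" "B v v > 0" "B u u > 0" "B v u = 0"
    using positive_orthogonal_pair[OF assms] .
  then have "u \<in> orth v" by (simp add: orth_def)
  show ?thesis
  proof (cases "symmetric_on (orth v)")
    case True
    from symmetric_orth_replacement[OF dim vu(1,3) \<open>u \<in> orth v\<close> vu(4) True not_sym]
    show ?thesis using that by blast
  qed (use vu \<open>u \<in> orth v\<close> that in blast)
qed

end

section \<open>Gram determinants\<close>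

context vector_space
begin

lemma ordered_basis_exists:
  assumes "finite_dimensional_vector_space scale Basis" "subspace W"
  obtains bs where "ordered_basis scale W bs"
proof -
  interpret finite_dimensional_vector_space scale Basis by fact
  obtain C where C: "C \<subseteq> W" "independent C" "W \<subseteq> span C" "card C = dim W"
    using basis_exists by blast
  then obtain bs where "set bs = C" "distinct bs"
    using finiteI_independent finite_distinct_list by blast
  with C assms(2) have "ordered_basis scale W bs"
    by (auto simp: ordered_basis_def span_minimal[THEN subsetD])
  then show ?thesis ..
qed

lemma ordered_basis_expansion:
  assumes "ordered_basis scale W bs" "x \<in> W"
  obtains a where "x = (\<Sum>j<length bs. scale (a j) (bs ! j))"
proof -
  have "x = (\<Sum>b\<in>set bs. scale (representation (set bs) x b) b)"
    using assms by (simp add: ordered_basis_def sum_representation_eq)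
  also have "\<dots> = (\<Sum>j<length bs. scale (representation (set bs) x (bs ! j)) (bs ! j))"
    using assms(1) bij_betw_nth[of bs "{..<length bs}" "set bs"]
    by (intro sum.reindex_bij_betw[symmetric]) (simp add: ordered_basis_def)
  finally show ?thesis by (rule that)
qed

lemma ordered_basis_length:
  "ordered_basis scale W bs \<Longrightarrow> length bs = dim W"
  by (auto simp: ordered_basis_def distinct_card dim_eq_card_independent)

lemma ordered_basis_subset:
  "ordered_basis scale W bs \<Longrightarrow> set bs \<subseteq> W"
  using span_base by (auto simp: ordered_basis_def)

end

context bilinear_form_on
begin

definition gram :: "'v list \<Rightarrow> 'a mat" where
  "gram bs = mat (length bs) (length bs) (\<lambda>(i, j). B (bs ! i) (bs ! j))"

lemma gram_carrier: "gram bs \<in> carrier_mat (length bs) (length bs)"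
  by (simp add: gram_def)

lemma sum_left:
  "finite J \<Longrightarrow> (\<And>j. j \<in> J \<Longrightarrow> b j \<in> W) \<Longrightarrow> y \<in> W \<Longrightarrow>
    B (\<Sum>j\<in>J. scale (a j) (b j)) y = (\<Sum>j\<in>J. a j * B (b j) y)"
  by (induction J rule: finite_induct)
     (simp_all add: expand subspace_sum[OF subspace_W])

lemma sum_right:
  "finite J \<Longrightarrow> (\<And>j. j \<in> J \<Longrightarrow> b j \<in> W) \<Longrightarrow> y \<in> W \<Longrightarrow>
    B y (\<Sum>j\<in>J. scale (a j) (b j)) = (\<Sum>j\<in>J. a j * B y (b j))"
  by (induction J rule: finite_induct)
     (simp_all add: expand subspace_sum[OF subspace_W])

lemma det_gram_change_basis:
  assumes bs: "ordered_basis scale W bs" and cs: "ordered_basis scale W cs"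
  obtains d where "det (gram cs) = d^2 * det (gram bs)"
proof -
  let ?n = "length bs"
  have len: "length cs = ?n" using bs cs by (simp add: ordered_basis_length)
  have bsW: "bs ! j \<in> W" if "j < ?n" for j
    using ordered_basis_subset[OF bs] that by auto
  have csW: "cs ! j \<in> W" if "j < ?n" for j
    using ordered_basis_subset[OF cs] that len by auto
  have "\<forall>i. \<exists>a. i < ?n \<longrightarrow> cs ! i = (\<Sum>j<?n. scale (a j) (bs ! j))"
    using ordered_basis_expansion[OF bs csW] by metis
  then obtain a where a: "cs ! i = (\<Sum>j<?n. scale (a i j) (bs ! j))" if "i < ?n" for i
    by metis
  \<comment> \<open>The rows of \<open>P\<close> are the coordinates of \<open>cs\<close> with
    respect to \<open>bs\<close>.\<close>
  define P where "P = mat ?n ?n (\<lambda>(i, j). a i j)"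
  have P: "P \<in> carrier_mat ?n ?n" by (simp add: P_def)
  have G: "gram bs \<in> carrier_mat ?n ?n" by (rule gram_carrier)
  have entry: "B (cs ! i) (cs ! k) = (\<Sum>l<?n. (\<Sum>j<?n. a i j * B (bs ! j) (bs ! l)) * a k l)"
    if "i < ?n" "k < ?n" for i k
  proof -
    have "B (cs ! i) (cs ! k) = (\<Sum>l<?n. a k l * B (cs ! i) (bs ! l))"
      unfolding a[OF that(2)] using csW[OF that(1)] bsW by (intro sum_right) auto
    also have "\<dots> = (\<Sum>l<?n. a k l * (\<Sum>j<?n. a i j * B (bs ! j) (bs ! l)))"
      unfolding a[OF that(1)] using bsW by (intro sum.cong refl arg_cong2[where f = "(*)"] sum_left) auto
    finally show ?thesis by (simp add: mult.commute)
  qed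
  have "gram cs = P * gram bs * transpose_mat P"
    by (rule eq_matI)
       (simp_all add: gram_def P_def len entry scalar_prod_def lessThan_atLeast0)
  then have "det (gram cs) = det P * det (gram bs) * det (transpose_mat P)"
    using P G by (simp add: det_mult[of _ ?n])
  also have "\<dots> = (det P)^2 * det (gram bs)"
    using P by (simp add: det_transpose power2_eq_square)
  finally show ?thesis by (rule that)
qed

text \<open>The change of basis formula does not assert that its square factor is non-zero; applying
  it in both directions makes up for this.\<close>

lemma det_gram_pos_iff:
  assumes "ordered_basis scale W bs" "ordered_basis scale W cs"
  shows "det (gram cs) > 0 \<longleftrightarrow> det (gram bs) > 0"
proof -
  obtain d e where "det (gram cs) = d^2 * det (gram bs)" "det (gram bs) = e^2 * det (gram cs)"
    using det_gram_change_basis assms by metis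
  then show ?thesis by (metis zero_less_mult_pos zero_le_power2 mult_zero_left order_le_less)
qed

text \<open>The first row vanishes off the diagonal, so the matrix is block triangular; the first
  column is arbitrary.\<close>

lemma det_gram_Cons:
  assumes "\<And>b. b \<in> set bs \<Longrightarrow> B v b = 0"
  shows "det (gram (v # bs)) = B v v * det (gram bs)"
proof -
  let ?n = "length bs"
  define C where "C = mat ?n 1 (\<lambda>(i, _). B (bs ! i) v)"
  have "gram (v # bs) = four_block_mat (mat 1 1 (\<lambda>_. B v v)) (0\<^sub>m 1 ?n) C (gram bs)"
    using assms
    by (intro eq_matI) (auto simp: gram_def C_def nth_Cons' less_Suc_eq_0_disj)
  then show ?thesis
    by (simp add: det_four_block_mat_upper_right_zero[of _ 1 _ ?n] C_def gram_carrier det_single)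
qed

lemma ordered_basis_Cons:
  assumes v: "v \<in> W" "B v v \<noteq> 0" and bs: "ordered_basis scale (orth v) bs"
  shows "ordered_basis scale W (v # bs)"
proof -
  have "v \<notin> span (set bs)" using v bs by (auto simp: ordered_basis_def orth_def)
  moreover have "v \<notin> set bs" using calculation span_base by blast
  moreover have "span (insert v (set bs)) = W"
  proof
    have "set bs \<subseteq> W" using ordered_basis_subset[OF bs] orth_subset by blast
    then show "span (insert v (set bs)) \<subseteq> W"
      using v by (intro span_minimal subspace_W) auto
    show "W \<subseteq> span (insert v (set bs))"
      unfolding span_insert using bs orth_decomposition[OF v] by (auto simp: ordered_basis_def)
  qed
  ultimately show ?thesis using bs by (simp add: ordered_basis_def independent_insert)
qed

end

section \<open>Isometries and reflections\<close>

context quadratic_space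
begin

lemma polar_add:
  "polar Q (u + u') v = polar Q u v + polar Q u' v"
  "polar Q u (v + v') = polar Q u v + polar Q u v'"
  using polar_diff(1)[of "u + u'" u' v] polar_diff(2)[of u "v + v'" v'] by (simp_all add: eq_diff_eq)

lemma polar_scale:
  "polar Q (scale a u) v = a * polar Q u v"
  "polar Q u (scale a v) = a * polar Q u v"
proof -
  interpret l: Vector_Spaces.linear scale "(*)" "\<lambda>u. polar Q u v" by (rule polar_linear_left)
  interpret r: Vector_Spaces.linear scale "(*)" "\<lambda>v. polar Q u v" by (rule polar_linear_right)
  show "polar Q (scale a u) v = a * polar Q u v" by (rule l.scale)
  show "polar Q u (scale a v) = a * polar Q u v" by (rule r.scale)
qed

lemma polar_commute: "polar Q u v = polar Q v u"
  by (simp add: polar_def add.commute)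

lemma polar_self: "polar Q u u = 2 * Q u"
proof -
  have "Q (u + u) = 4 * Q u" using Q_scale[of 2 u] scale_left_distrib[of 1 1 u] by simp
  then show ?thesis by (simp add: polar_def)
qed

lemma Q_0 [simp]: "Q 0 = 0"
  using Q_scale[of 0 0] by simp

lemma Q_add: "Q (u + v) = Q u + Q v + polar Q u v"
  by (simp add: polar_def)

lemma Q_diff: "Q (u - v) = Q u + Q v - polar Q u v"
proof -
  have "Q ((u - v) + v) = Q (u - v) + Q v + polar Q (u - v) v" by (rule Q_add)
  then show ?thesis by (simp add: polar_diff polar_self algebra_simps)
qed

lemma isometryD:
  assumes "f \<in> isometries scale Q"
  shows isometry_add: "f (u + v) = f u + f v" and isometry_diff: "f (u - v) = f u - f v"
    and isometry_scale: "f (scale a u) = scale a (f u)" and isometry_0: "f 0 = 0"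
    and isometry_neg: "f (- u) = - f u"
    and isometry_Q: "Q (f u) = Q u" and isometry_polar: "polar Q (f u) (f v) = polar Q u v"
    and isometry_bij: "bij f"
proof -
  interpret f: Vector_Spaces.linear scale scale f using assms by (simp add: isometries_def)
  show "f (u + v) = f u + f v" "f (u - v) = f u - f v" "f (scale a u) = scale a (f u)" "f 0 = 0" "f (- u) = - f u"
    by (rule f.add f.diff f.scale f.zero f.neg)+
  show "Q (f u) = Q u" "bij f" using assms by (simp_all add: isometries_def)
  show "polar Q (f u) (f v) = polar Q u v"
    using assms unfolding polar_def isometries_def by (simp flip: f.add)
qed

lemma subspace_Mov:
  assumes "f \<in> isometries scale Q"
  shows "subspace (Mov f)"
  unfolding subspace_def Mov_def
proof (intro conjI ballI allI)
  note f = isometryD[OF assms]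
  show "0 \<in> range (\<lambda>w. w - f w)" by (rule range_eqI[of _ _ 0]) (simp add: f)
  fix x y a assume "x \<in> range (\<lambda>w. w - f w)"
  then obtain w where w: "x = w - f w" by blast
  show "scale a x \<in> range (\<lambda>w. w - f w)"
    by (rule range_eqI[of _ _ "scale a w"]) (simp add: f w scale_right_diff_distrib)
  assume "y \<in> range (\<lambda>w. w - f w)"
  then obtain z where z: "y = z - f z" by blast
  show "x + y \<in> range (\<lambda>w. w - f w)"
    by (rule range_eqI[of _ _ "w + z"]) (simp add: f w z)
qed

lemma MovI: "w - f w \<in> Mov f" by (simp add: Mov_def)

lemma MovE:
  assumes "u \<in> Mov f"
  obtains w where "u = w - f w"
  using assms by (auto simp: Mov_def)

text \<open>With \<open>u = w - f w\<close>, expand \<open>Q (w - u) = Q (f w) = Q w\<close>.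
  Positive vectors of the Wall form are therefore those of \<open>Q\<close>.\<close>

lemma wall_form_self:
  assumes f: "f \<in> isometries scale Q" and u: "u \<in> Mov f"
  shows "wall_form Q f u u = Q u"
proof -
  obtain w where w: "u = w - f w" using u by (rule MovE)
  have "Q (f w) = Q (w - u)" by (simp add: w)
  then have "polar Q w u = Q u" by (simp add: Q_diff isometry_Q[OF f])
  then show ?thesis using wall_form_eq[OF f u, of w] w by simp
qed

lemma wall_form_add_swap:
  assumes f: "f \<in> isometries scale Q" and u: "u \<in> Mov f" and v: "v \<in> Mov f"
  shows "wall_form Q f u v + wall_form Q f v u = polar Q u v"
proof -
  obtain w where w: "u = w - f w" using u by (rule MovE)
  obtain z where z: "v = z - f z" using v by (rule MovE)
  have "polar Q (f w) (f z) = polar Q w z" by (rule isometry_polar[OF f])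
  then show ?thesis using wall_form_eq[OF f v, of w] wall_form_eq[OF f u, of z]
    by (simp add: w z polar_diff polar_commute[of z])
qed

text \<open>Up to sign, \<open>f\<close> is the asymmetry of its own Wall form; this underlies the
  symmetry criterion for involutions.\<close>

lemma wall_form_twist:
  assumes f: "f \<in> isometries scale Q" and u: "u \<in> Mov f" and v: "v \<in> Mov f"
  shows "f v \<in> Mov f" "wall_form Q f (f v) u = - wall_form Q f u v"
proof -
  obtain w where w: "u = w - f w" using u by (rule MovE)
  obtain z where z: "v = z - f z" using v by (rule MovE)
  have fz: "f v = f z - f (f z)" by (simp add: z isometry_diff[OF f])
  then show "f v \<in> Mov f" by (simp add: MovI)
  have "wall_form Q f (f v) u = polar Q (f z) u" unfolding fz by (rule wall_form_eq[OF f u])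
  also have "\<dots> = polar Q (f z) w - polar Q z w" by (simp add: w polar_diff isometry_polar[OF f])
  also have "\<dots> = - polar Q w v" by (simp add: z polar_diff polar_commute)
  also have "polar Q w v = wall_form Q f u v" unfolding w by (rule wall_form_eq[OF f v, symmetric])
  finally show "wall_form Q f (f v) u = - wall_form Q f u v" .
qed

lemma reflection_reflection:
  assumes "Q v \<noteq> 0"
  shows "reflection scale Q v (reflection scale Q v u) = u"
proof -
  have "polar Q (reflection scale Q v u) v = - polar Q u v"
    using assms by (simp add: reflection_def polar_diff polar_scale polar_self)
  then show ?thesis by (simp add: reflection_def)
qed

lemma reflection_comp_reflection:
  "Q v \<noteq> 0 \<Longrightarrow> reflection scale Q v \<circ> (reflection scale Q v \<circ> f) = f"
  by (simp add: fun_eq_iff reflection_reflection)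

lemma reflection_isometry:
  assumes "Q v \<noteq> 0"
  shows "reflection scale Q v \<in> isometries scale Q"
proof -
  have "Vector_Spaces.linear scale scale (reflection scale Q v)"
    by unfold_locales
      (simp_all add: reflection_def polar_add polar_scale add_divide_distrib
        scale_left_distrib scale_right_diff_distrib)
  moreover have "bij (reflection scale Q v)"
    by (rule o_bij[of "reflection scale Q v"]) (simp_all add: fun_eq_iff reflection_reflection assms)
  moreover have "Q (reflection scale Q v u) = Q u" for u
    using assms by (simp add: reflection_def Q_diff Q_scale polar_scale power2_eq_square)
  ultimately show ?thesis by (simp add: isometries_def)
qed

lemma isometries_comp:
  assumes "f \<in> isometries scale Q" "g \<in> isometries scale Q"
  shows "f \<circ> g \<in> isometries scale Q"
  using assms by (auto simp: isometries_def intro: bij_comp Vector_Spaces.linear_compose)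

lemma reflection_minus_self:
  assumes "Q v \<noteq> 0"
  shows "reflection scale Q v (- v) = v"
proof -
  have "reflection scale Q v v = v - scale (1 + 1) v"
    using assms by (simp add: reflection_def polar_self)
  also have "\<dots> = - v" unfolding scale_left_distrib by simp
  finally show ?thesis using isometry_neg[OF reflection_isometry[OF assms], of v] by simp
qed

lemma reflection_comp_move:
  "w - reflection scale Q v (f w) = (w - f w) + scale (polar Q (f w) v / Q v) v"
  by (simp add: reflection_def)

end

section \<open>The Wall form under multiplication by a reflection\<close>

locale square_dense_quadratic_space = nondegenerate_quadratic_space scale Basis Q
  for scale :: "'a::square_dense_field \<Rightarrow> 'v::ab_group_add \<Rightarrow> 'v" and Basis Q
begin

text \<open>By invariance \<open>polar Q (f w) (f z) = polar Q w z = polar Q w (f z)\<close>, so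
  \<open>f w - w\<close> is orthogonal to the range of \<open>f\<close>, which is
  everything.\<close>

lemma orthogonal_to_Mov:
  assumes f: "f \<in> isometries scale Q" and w: "\<And>z. polar Q w (z - f z) = 0"
  shows "f w = w"
proof -
  have "polar Q (f w - w) y = 0" for y
  proof -
    obtain z where z: "y = f z" using isometry_bij[OF f] by (metis bij_pointE)
    show ?thesis using w[of z] by (simp add: z polar_diff isometry_polar[OF f])
  qed
  then show ?thesis using nondegenerate[of "f w - w"] by simp
qed

text \<open>If \<open>w - f w\<close> is in the left radical, then \<open>w\<close> is orthogonal to
  \<open>Mov f\<close> and hence fixed. A vector in the right radical pairs to zero with every
  \<open>w\<close> of the whole space.\<close>

lemma wall_form_nondegenerate:
  assumes f: "f \<in> isometries scale Q"
  shows "nondegenerate_form_on scale Basis (Mov f) (wall_form Q f)"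
proof unfold_locales
  note wf = wall_form_eq[OF f] and M = subspace_Mov[OF f]
  show "subspace (Mov f)" by (rule M)
  fix u u' v v' a assume u: "u \<in> Mov f" and v: "v \<in> Mov f"
  obtain w where w: "u = w - f w" using u by (rule MovE)
  have "scale a u = scale a w - f (scale a w)"
    by (simp add: w isometry_scale[OF f] scale_right_diff_distrib)
  then show "wall_form Q f (scale a u) v = a * wall_form Q f u v"
    using wf[OF v, of "scale a w"] wf[OF v, of w] by (simp add: w polar_scale)
  show "wall_form Q f u (scale a v) = a * wall_form Q f u v"
    using wf[OF v, of w] wf[OF subspace_scale[OF M v], of w] by (simp add: w polar_scale)
  show "u = 0" if "\<And>y. y \<in> Mov f \<Longrightarrow> wall_form Q f u y = 0"
  proof -
    have "polar Q w (z - f z) = 0" for z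
      using that[OF MovI[of z f]] wf[OF MovI, of w] by (simp add: w)
    then show ?thesis using orthogonal_to_Mov[OF f] w by simp
  qed
  show "v = 0" if "\<And>x. x \<in> Mov f \<Longrightarrow> wall_form Q f x v = 0"
  proof (rule nondegenerate)
    show "polar Q v z = 0" for z
      using that[OF MovI[of z f]] wf[OF v, of z] by (simp add: polar_commute)
  qed
  { assume u': "u' \<in> Mov f"
    obtain w' where w': "u' = w' - f w'" using u' by (rule MovE)
    have "u + u' = (w + w') - f (w + w')" by (simp add: w w' isometry_add[OF f])
    then show "wall_form Q f (u + u') v = wall_form Q f u v + wall_form Q f u' v"
      using wf[OF v, of "w + w'", folded \<open>u + u' = _\<close>] wf[OF v, of w, folded w] wf[OF v, of w', folded w']
      by (simp add: polar_add) }
  { assume v': "v' \<in> Mov f"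
    show "wall_form Q f u (v + v') = wall_form Q f u v + wall_form Q f u v'"
      using wf[OF v, of w] wf[OF v', of w] wf[OF subspace_add[OF M v v'], of w]
      by (simp add: w polar_add) }
qed

lemma Mov_trivial: "dim (Mov f) = 0 \<longleftrightarrow> f = id"
proof
  assume "dim (Mov f) = 0"
  then have "w - f w = 0" for w using MovI[of w f] by auto
  then show "f = id" by (simp add: fun_eq_iff)
qed (simp add: Mov_def image_subset_iff)

section \<open>Functionals and the orthogonal complement of the fixed vectors\<close>

lemma vector_space_pair_field: "vector_space_pair scale ((*) :: 'a \<Rightarrow> 'a \<Rightarrow> 'a)"
  by unfold_locales (simp_all add: distrib_left distrib_right)

lemma Riesz_representation:
  assumes "Vector_Spaces.linear scale (*) \<psi>"
  obtains w where "\<And>x. polar Q w x = \<psi> x"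
proof -
  interpret \<psi>: Vector_Spaces.linear scale "(*)" \<psi> by fact
  \<comment> \<open>Injectivity of this endomorphism is non-degeneracy, and finite dimension turns
    it into surjectivity.\<close>
  define \<phi> where "\<phi> u = (\<Sum>b\<in>Basis. scale (polar Q u b) b)" for u
  have lin: "Vector_Spaces.linear scale scale \<phi>"
    by unfold_locales
      (simp_all add: \<phi>_def polar_add polar_scale scale_left_distrib sum.distrib scale_sum_right)
  interpret \<phi>: Vector_Spaces.linear scale scale \<phi> by (rule lin)
  have rep: "representation Basis (\<Sum>b\<in>Basis. scale (h b) b) c = h c" if "c \<in> Basis" for h c
    using that finite_Basis independent_Basis
    by (simp add: representation_sum representation_scale representation_basis span_base span_scale if_distrib cong: if_cong)
  have ext: "g x = h x" if "Vector_Spaces.linear scale (*) g" "Vector_Spaces.linear scale (*) h"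
    "\<And>b. b \<in> Basis \<Longrightarrow> g b = h b" for g h x
  proof -
    interpret pair: vector_space_pair scale "(*)" by (rule vector_space_pair_field)
    show ?thesis using that pair.linear_eq_on[of g h x Basis] by (simp add: span_Basis)
  qed
  have "inj \<phi>"
    unfolding \<phi>.inj_iff_eq_0
  proof (intro allI impI)
    fix u assume u: "\<phi> u = 0"
    have "polar Q u b = 0" if "b \<in> Basis" for b
      using rep[OF that, of "polar Q u"] u by (simp add: \<phi>_def[symmetric] representation_zero)
    moreover have "Vector_Spaces.linear scale (*) (\<lambda>_. 0)" by unfold_locales simp_all
    ultimately show "u = 0"
      using nondegenerate[of u] ext[OF polar_linear_right, of "\<lambda>_. 0" u] by simp
  qed
  then obtain w where w: "\<phi> w = (\<Sum>b\<in>Basis. scale (\<psi> b) b)"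
    using linear_inj_imp_surj[OF lin] by (metis surj_def)
  have "polar Q w b = \<psi> b" if "b \<in> Basis" for b
    using rep[OF that, of "polar Q w"] rep[OF that, of \<psi>] w by (simp add: \<phi>_def)
  then have "polar Q w x = \<psi> x" for x using ext[OF polar_linear_right assms] by blast
  then show ?thesis by (rule that)
qed

text \<open>Otherwise a functional vanishing on \<open>Mov f\<close> with value 1 at
  \<open>v\<close> is represented by some \<open>w\<close>. This \<open>w\<close> is orthogonal to
  \<open>Mov f\<close>, hence fixed, yet pairs with \<open>v\<close> to 1.\<close>

lemma in_Mov_if_orthogonal_fixed:
  assumes f: "f \<in> isometries scale Q" and v: "\<And>w. f w = w \<Longrightarrow> polar Q w v = 0"
  shows "v \<in> Mov f"
proof (rule ccontr)
  assume nv: "v \<notin> Mov f"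
  interpret pair: vector_space_pair scale "(*)" by (rule vector_space_pair_field)
  obtain C where C: "C \<subseteq> Mov f" "independent C" "Mov f \<subseteq> span C" "card C = dim (Mov f)"
    by (rule basis_exists)
  have "span C \<subseteq> Mov f" using C subspace_Mov[OF f] by (intro span_minimal)
  then have ind: "independent (insert v C)" using C nv by (auto simp: independent_insert)
  obtain \<psi> where \<psi>: "Vector_Spaces.linear scale (*) \<psi>" "\<And>x. x \<in> insert v C \<Longrightarrow> \<psi> x = (if x = v then 1 else 0)"
    using pair.linear_independent_extend[OF ind, of "\<lambda>x. if x = v then 1 else 0"] by blast
  have zero: "Vector_Spaces.linear scale (*) (\<lambda>_. 0)" by unfold_locales simp_all
  obtain w where w: "\<And>x. polar Q w x = \<psi> x" using Riesz_representation[OF \<psi>(1)] by blast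
  have "\<psi> b = 0" if "b \<in> C" for b using C(1) nv \<psi>(2) that by auto
  then have "\<psi> x = 0" if "x \<in> Mov f" for x
    using pair.linear_eq_on[OF \<psi>(1) zero, of x C] C(3) that by blast
  then have "f w = w" using w by (intro orthogonal_to_Mov[OF f]) (simp add: MovI)
  with v w \<psi>(2)[of v] show False by fastforce
qed

text \<open>The displacement \<open>w - g w\<close> is the projection of \<open>w - f w\<close>
  along \<open>v\<close> onto \<open>orth v\<close>. The two differ by a multiple of
  \<open>v\<close>, on which the Wall form with second argument in \<open>orth v\<close> vanishes,
  so both isometries induce the same form there.\<close>

lemma Mov_reflection_comp:
  assumes f: "f \<in> isometries scale Q" and v: "v \<in> Mov f" "Q v \<noteq> 0"
  defines "g \<equiv> reflection scale Q v \<circ> f"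
  shows "g \<in> isometries scale Q"
    and "Mov g = bilinear_form_on.orth (Mov f) (wall_form Q f) v"
    and "x \<in> Mov g \<Longrightarrow> y \<in> Mov g \<Longrightarrow> wall_form Q g x y = wall_form Q f x y"
    and "dim (Mov f) = dim (Mov g) + 1"
proof -
  interpret X: nondegenerate_form_on scale Basis "Mov f" "wall_form Q f"
    by (rule wall_form_nondegenerate[OF f])
  show g: "g \<in> isometries scale Q"
    unfolding g_def by (intro isometries_comp reflection_isometry f v)
  have vv: "wall_form Q f v v = Q v" by (rule wall_form_self[OF f v(1)])
  have move: "w - g w = (w - f w) - scale (wall_form Q f v (w - f w) / Q v) v" for w
  proof -
    have "polar Q (f w) v = polar Q w v - polar Q (w - f w) v" by (simp add: polar_diff)
    also have "\<dots> = - wall_form Q f v (w - f w)"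
      using wall_form_add_swap[OF f MovI v(1), of w] wall_form_eq[OF f v(1), of w] by simp
    finally show ?thesis by (simp add: g_def reflection_comp_move)
  qed
  show M: "Mov g = X.orth v"
  proof
    show "Mov g \<subseteq> X.orth v"
      using X.orth_decomposition[OF v(1), of "w - f w" for w] v(2)
      by (auto simp: vv move MovI elim!: MovE)
    show "X.orth v \<subseteq> Mov g"
    proof
      fix u assume u: "u \<in> X.orth v"
      then obtain w where "u = w - f w" by (auto simp: X.orth_def elim: MovE)
      with u move[of w] show "u \<in> Mov g" using MovI[of w g] by (simp add: X.orth_def)
    qed
  qed
  show "wall_form Q g x y = wall_form Q f x y" if xg: "x \<in> Mov g" and yg: "y \<in> Mov g"
  proof -
    have y: "y \<in> Mov f" "wall_form Q f v y = 0" using yg by (auto simp: M X.orth_def)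
    obtain w where w: "x = w - g w" using xg by (rule MovE)
    have "wall_form Q g x y = wall_form Q f (w - f w) y"
      using wall_form_eq[OF g yg, of w] wall_form_eq[OF f y(1), of w] by (simp add: w)
    also have "\<dots> = wall_form Q f x y"
      unfolding w move using v y by (simp add: X.expand MovI)
    finally show ?thesis .
  qed
  show "dim (Mov f) = dim (Mov g) + 1"
    unfolding M using X.dim_orth[OF v(1)] v(2) by (simp add: vv)
qed

text \<open>As \<open>v\<close> is not in \<open>Mov f\<close>, some fixed vector \<open>w\<close>
  is not orthogonal to \<open>v\<close>, and \<open>g\<close> displaces it by a non-zero multiple of
  \<open>v\<close>. Then \<open>Mov_reflection_comp\<close> applies to \<open>g\<close>.\<close>

lemma Mov_reflection_comp_new:
  assumes f: "f \<in> isometries scale Q" and v: "v \<notin> Mov f" "Q v \<noteq> 0"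
  defines "g \<equiv> reflection scale Q v \<circ> f"
  shows "g \<in> isometries scale Q" "v \<in> Mov g" "reflection scale Q v \<circ> g = f"
    "dim (Mov g) = dim (Mov f) + 1"
proof -
  show g: "g \<in> isometries scale Q"
    unfolding g_def by (intro isometries_comp reflection_isometry f v)
  show rg: "reflection scale Q v \<circ> g = f" using v by (simp add: g_def reflection_comp_reflection)
  obtain w where w: "f w = w" "polar Q w v \<noteq> 0"
    using in_Mov_if_orthogonal_fixed[OF f] v(1) by blast
  have "w - g w = scale (polar Q w v / Q v) v"
    using w by (simp add: g_def reflection_def)
  then have "scale (polar Q w v / Q v) v \<in> Mov g" using MovI[of w g] by simp
  then have "scale (Q v / polar Q w v) (scale (polar Q w v / Q v) v) \<in> Mov g"
    by (rule subspace_scale[OF subspace_Mov[OF g]])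
  then show "v \<in> Mov g" using w v by simp
  then show "dim (Mov g) = dim (Mov f) + 1"
    using Mov_reflection_comp(4)[OF g _ v(2)] rg by simp
qed

lemma positive_isometry_iff_det:
  assumes f: "f \<in> isometries scale Q" and bs: "ordered_basis scale (Mov f) bs"
  shows "f \<in> positive_isometries scale Q \<longleftrightarrow> det (wall_matrix Q f bs) > 0"
proof -
  interpret X: nondegenerate_form_on scale Basis "Mov f" "wall_form Q f"
    by (rule wall_form_nondegenerate[OF f])
  have gram: "wall_matrix Q f cs = X.gram cs" for cs
    by (simp add: wall_matrix_def X.gram_def)
  show ?thesis
    using f X.det_gram_pos_iff[OF bs someI[of "ordered_basis scale (Mov f)", OF bs]]
    by (simp add: positive_isometries_def spinor_norm_def positive_class_square_class gram)
qed

text \<open>Putting \<open>v\<close> in front of a basis of the smaller moved space gives a basis of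
  \<open>Mov f\<close> and multiplies the determinant by \<open>Q v\<close>.\<close>

lemma positive_isometry_reflection_comp:
  assumes f: "f \<in> isometries scale Q" and v: "v \<in> Mov f" "Q v > 0"
  shows "reflection scale Q v \<circ> f \<in> positive_isometries scale Q \<longleftrightarrow> f \<in> positive_isometries scale Q"
proof -
  define g where "g = reflection scale Q v \<circ> f"
  interpret X: nondegenerate_form_on scale Basis "Mov f" "wall_form Q f"
    by (rule wall_form_nondegenerate[OF f])
  have "Q v \<noteq> 0" using v by simp
  note g = Mov_reflection_comp[OF f v(1) this, folded g_def]
  have vv: "wall_form Q f v v = Q v" by (rule wall_form_self[OF f v(1)])
  obtain bs where bs: "ordered_basis scale (Mov g) bs"
    using ordered_basis_exists[OF finite_dimensional_vector_space_axioms subspace_Mov[OF g(1)]] .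
  then have sub: "set bs \<subseteq> Mov g" by (rule ordered_basis_subset)
  have bs': "ordered_basis scale (Mov f) (v # bs)"
    using X.ordered_basis_Cons[OF v(1)] bs v(2) by (simp add: vv g(2))
  have "det (wall_matrix Q f (v # bs)) = Q v * det (X.gram bs)"
    using X.det_gram_Cons[of bs v] sub by (auto simp: wall_matrix_def X.gram_def vv g(2) X.orth_def)
  also have "X.gram bs = wall_matrix Q g bs"
    using sub by (auto simp: wall_matrix_def X.gram_def g(3) subset_iff intro!: eq_matI)
  finally show ?thesis
    using v(2) positive_isometry_iff_det[OF f bs'] positive_isometry_iff_det[OF g(1) bs]
    by (simp add: zero_less_mult_iff g_def)
qed

section \<open>Involutions and symmetric Wall forms\<close>

lemma involution_Mov:
  assumes f: "f \<in> isometries scale Q" and "involution f" "v \<in> Mov f"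
  shows "f v = - v"
proof -
  obtain w where "v = w - f w" using assms(3) by (rule MovE)
  moreover have "f (f w) = w" using assms(2) by (metis comp_apply id_apply involution_def)
  ultimately show ?thesis by (simp add: isometry_diff[OF f])
qed

text \<open>By \<open>wall_form_twist\<close> and non-degeneracy, symmetry means
  \<open>f v = - v\<close> on \<open>Mov f\<close>; for \<open>v = w - f w\<close> this says
  \<open>f (f w) = w\<close>.\<close>

lemma involution_iff_symmetric:
  assumes f: "f \<in> isometries scale Q"
  shows "involution f \<longleftrightarrow> bilinear_form_on.symmetric_on (wall_form Q f) (Mov f)"
proof -
  interpret X: nondegenerate_form_on scale Basis "Mov f" "wall_form Q f"
    by (rule wall_form_nondegenerate[OF f])
  note twist = wall_form_twist[OF f]
  show ?thesis
  proof
    assume inv: "involution f"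
    have "wall_form Q f u v = wall_form Q f v u" if "u \<in> Mov f" "v \<in> Mov f" for u v
      using twist[OF that] involution_Mov[OF f inv that(2)] X.scale_left[OF that(2,1), of "- 1"] that by simp
    then show "X.symmetric_on (Mov f)" by (simp add: X.symmetric_on_def)
  next
    assume sym: "X.symmetric_on (Mov f)"
    have neg: "f v = - v" if v: "v \<in> Mov f" for v
    proof -
      have "v + f v = 0"
      proof (rule X.nondegenerate_left)
        show "v + f v \<in> Mov f" using twist(1)[OF v v] v by simp
        fix u assume u: "u \<in> Mov f"
        then show "wall_form Q f (v + f v) u = 0"
          using twist[OF u v] v sym by (simp add: X.add_left X.add_right X.symmetric_on_def)
      qed
      then show ?thesis by (simp add: eq_neg_iff_add_eq_0 add.commute)
    qed
    have "f (f w) = w" for w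
      using neg[OF MovI[of w f]] by (simp add: isometry_diff[OF f])
    then show "involution f" by (simp add: involution_def fun_eq_iff)
  qed
qed

lemma involution_reflection_comp:
  assumes f: "f \<in> isometries scale Q" and v: "v \<in> Mov f" "Q v \<noteq> 0"
  shows "involution (reflection scale Q v \<circ> f) \<longleftrightarrow>
    bilinear_form_on.symmetric_on (wall_form Q f) (bilinear_form_on.orth (Mov f) (wall_form Q f) v)"
proof -
  interpret X: nondegenerate_form_on scale Basis "Mov f" "wall_form Q f"
    by (rule wall_form_nondegenerate[OF f])
  note g = Mov_reflection_comp[OF f v]
  interpret Y: nondegenerate_form_on scale Basis "Mov (reflection scale Q v \<circ> f)" "wall_form Q (reflection scale Q v \<circ> f)"
    by (rule wall_form_nondegenerate[OF g(1)])
  show ?thesis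
    by (simp add: involution_iff_symmetric[OF g(1)] X.symmetric_on_def Y.symmetric_on_def g(3) flip: g(2))
qed

lemma involution_reflection_compI:
  assumes f: "f \<in> isometries scale Q" and v: "v \<in> Mov f" "Q v \<noteq> 0" and "involution f"
  shows "involution (reflection scale Q v \<circ> f)"
proof -
  interpret X: nondegenerate_form_on scale Basis "Mov f" "wall_form Q f"
    by (rule wall_form_nondegenerate[OF f])
  show ?thesis using assms X.orth_subset[of v]
    by (auto simp: involution_reflection_comp involution_iff_symmetric X.symmetric_on_def)
qed

text \<open>The Wall form of an involution is symmetric, so \<open>orth v\<close> is orthogonal to
  \<open>v\<close> on both sides and \<open>Q\<close> is additive along the decomposition.\<close>

lemma positive_definite_Mov_extend:
  assumes f: "f \<in> isometries scale Q" and v: "v \<in> Mov f" "Q v > 0" and inv: "involution f"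
    and pd: "positive_definite Q (Mov (reflection scale Q v \<circ> f))"
  shows "positive_definite Q (Mov f)"
  unfolding positive_definite_def
proof (intro ballI impI)
  interpret X: nondegenerate_form_on scale Basis "Mov f" "wall_form Q f"
    by (rule wall_form_nondegenerate[OF f])
  note self = wall_form_self[OF f]
  fix x assume x: "x \<in> Mov f" "x \<noteq> 0"
  define t where "t = wall_form Q f v x / wall_form Q f v v"
  define k where "k = x - scale t v"
  have k: "k \<in> X.orth v"
    unfolding k_def t_def using v x by (intro X.orth_decomposition) (auto simp: self)
  then have k': "k \<in> Mov f" "wall_form Q f v k = 0" by (auto simp: X.orth_def)
  have "wall_form Q f k v = 0"
    using inv k' v by (simp add: involution_iff_symmetric[OF f] X.symmetric_on_def)
  moreover have "x = k + scale t v" by (simp add: k_def)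
  ultimately have "Q x = Q k + t^2 * Q v"
    using self[OF x(1)] self[OF k'(1)] self[OF v(1)] k' v by (simp add: X.expand power2_eq_square)
  moreover have "k \<in> Mov (reflection scale Q v \<circ> f)" using k Mov_reflection_comp(2)[OF f v(1)] v(2) by simp
  ultimately show "Q x > 0"
    using pd v(2) \<open>x = k + scale t v\<close> x(2)
    by (cases "k = 0"; cases "t = 0") (auto simp: positive_definite_def intro: add_pos_pos)
qed

lemma product_of_positive_reflections_0:
  "product_of_positive_reflections scale Q 0 f \<longleftrightarrow> f = id"
  by (simp add: product_of_positive_reflections_def)

lemma product_of_positive_reflections_Suc:
  "product_of_positive_reflections scale Q (Suc k) f \<longleftrightarrow>
    (\<exists>v. Q v > 0 \<and> product_of_positive_reflections scale Q k (reflection scale Q v \<circ> f))"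
proof
  assume "product_of_positive_reflections scale Q (Suc k) f"
  then obtain v rs where v: "Q v > 0" and rs: "length rs = k" "set rs \<subseteq> positive_reflections scale Q"
    and f: "f = reflection scale Q v \<circ> foldr (\<circ>) rs id"
    by (auto simp: product_of_positive_reflections_def length_Suc_conv positive_reflections_def)
  then have "reflection scale Q v \<circ> f = foldr (\<circ>) rs id"
    by (simp add: reflection_comp_reflection)
  with v rs show "\<exists>v. Q v > 0 \<and> product_of_positive_reflections scale Q k (reflection scale Q v \<circ> f)"
    by (auto simp: product_of_positive_reflections_def)
next
  assume "\<exists>v. Q v > 0 \<and> product_of_positive_reflections scale Q k (reflection scale Q v \<circ> f)"
  then obtain v rs where v: "Q v > 0" and rs: "length rs = k" "set rs \<subseteq> positive_reflections scale Q"
    and f: "reflection scale Q v \<circ> f = foldr (\<circ>) rs id"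
    by (auto simp: product_of_positive_reflections_def)
  have "f = reflection scale Q v \<circ> (reflection scale Q v \<circ> f)"
    using v by (simp add: reflection_comp_reflection)
  then have "f = foldr (\<circ>) (reflection scale Q v # rs) id" by (simp add: f)
  then show "product_of_positive_reflections scale Q (Suc k) f"
    unfolding product_of_positive_reflections_def using v rs
    by (intro exI[of _ "reflection scale Q v # rs"]) (auto simp: positive_reflections_def)
qed

end

section \<open>Factorizations into positive reflections\<close>

context square_dense_quadratic_space
begin

lemma product_if_positive_definite:
  assumes "f \<in> isometries scale Q" "positive_definite Q (Mov f)"
  shows "product_of_positive_reflections scale Q (dim (Mov f)) f"
  using assms
proof (induction "dim (Mov f)" arbitrary: f)
  case 0
  then show ?case by (metis Mov_trivial product_of_positive_reflections_0)
next
  case (Suc n)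
  obtain v where v: "v \<in> Mov f" "v \<noteq> 0"
    using dim_positive_obtains_nonzero[of "Mov f"] Suc.hyps(2) by auto
  then have pos: "Q v > 0" using Suc.prems by (simp add: positive_definite_def)
  then have "Q v \<noteq> 0" by simp
  note g = Mov_reflection_comp[OF Suc.prems(1) v(1) this]
  interpret X: nondegenerate_form_on scale Basis "Mov f" "wall_form Q f"
    by (rule wall_form_nondegenerate[OF Suc.prems(1)])
  have "positive_definite Q (Mov (reflection scale Q v \<circ> f))"
    using Suc.prems(2) X.orth_subset[of v] by (auto simp: g(2) positive_definite_def)
  then have "product_of_positive_reflections scale Q n (reflection scale Q v \<circ> f)"
    using Suc.hyps(1)[OF _ g(1)] Suc.hyps(2) g(4) by simp
  then show ?case
    unfolding Suc.hyps(2)[symmetric] product_of_positive_reflections_Suc using pos by blast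
qed

lemma positive_definite_if_dim_1:
  assumes f: "f \<in> positive_isometries scale Q" and dim: "dim (Mov f) = 1"
  shows "positive_definite Q (Mov f)"
  unfolding positive_definite_def
proof (intro ballI impI)
  have iso: "f \<in> isometries scale Q" using f by (simp add: positive_isometries_def)
  obtain bs where bs: "ordered_basis scale (Mov f) bs"
    using ordered_basis_exists[OF finite_dimensional_vector_space_axioms subspace_Mov[OF iso]] .
  then have "length bs = 1" using dim by (simp add: ordered_basis_length)
  then obtain u where u: "bs = [u]" by (auto simp: length_Suc_conv)
  then have u_Mov: "u \<in> Mov f" "Mov f = span {u}"
    using ordered_basis_subset[OF bs] bs by (auto simp: ordered_basis_def)
  have "det (wall_matrix Q f bs) > 0" using f positive_isometry_iff_det[OF iso bs] by simp
  then have "Q u > 0"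
    using wall_form_self[OF iso u_Mov(1)] by (simp add: u wall_matrix_def det_single)
  moreover fix v assume "v \<in> Mov f" "v \<noteq> 0"
  then obtain a where "v = scale a u" "a \<noteq> 0" using u_Mov(2) by (auto simp: span_singleton)
  ultimately show "Q v > 0" by (simp add: Q_scale)
qed

text \<open>The induction carries along both the failure of symmetry and a positive vector
  \<open>p\<close>.\<close>

lemma product_if_not_involution:
  assumes "f \<in> positive_isometries scale Q" "\<not> involution f" "p \<in> Mov f" "Q p > 0"
  shows "product_of_positive_reflections scale Q (dim (Mov f)) f"
  using assms
proof (induction "dim (Mov f)" arbitrary: f p)
  case 0
  then show ?case by (metis Mov_trivial product_of_positive_reflections_0)
next
  case (Suc n)
  have iso: "f \<in> isometries scale Q" using Suc.prems by (simp add: positive_isometries_def)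
  interpret X: nondegenerate_form_on scale Basis "Mov f" "wall_form Q f"
    by (rule wall_form_nondegenerate[OF iso])
  note self = wall_form_self[OF iso]
  have step: ?case
    if v: "v \<in> Mov f" "Q v > 0"
      and g: "product_of_positive_reflections scale Q n (reflection scale Q v \<circ> f)" for v
    unfolding Suc.hyps(2)[symmetric] product_of_positive_reflections_Suc using v g by blast
  have dim_g: "dim (Mov (reflection scale Q v \<circ> f)) = n"
    and pos_g: "reflection scale Q v \<circ> f \<in> positive_isometries scale Q"
    if v: "v \<in> Mov f" "Q v > 0" for v
    using Mov_reflection_comp(4)[OF iso v(1)] positive_isometry_reflection_comp[OF iso v] v(2)
      Suc.hyps(2) Suc.prems(1) by simp_all
  consider "n = 0" | "n = 1" | "n \<ge> 2" by linarith
  then show ?case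
  proof cases
    case 1
    then have "positive_definite Q (Mov f)"
      using positive_definite_if_dim_1[OF Suc.prems(1)] Suc.hyps(2) by simp
    then show ?thesis by (rule product_if_positive_definite[OF iso])
  next
    case 2
    \<comment> \<open>In dimension 2 any positive vector can be split off: what remains is a
      positive isometry with one-dimensional moved space, whose sign the determinant
      decides.\<close>
    let ?g = "reflection scale Q p \<circ> f"
    have "positive_definite Q (Mov ?g)"
      using positive_definite_if_dim_1[OF pos_g] dim_g Suc.prems 2 by simp
    then have "product_of_positive_reflections scale Q n ?g"
      using product_if_positive_definite[of ?g] dim_g pos_g Suc.prems
      by (simp add: positive_isometries_def)
    with Suc.prems show ?thesis by (intro step)
  next
    case 3
    have "\<not> X.symmetric_on (Mov f)" using Suc.prems(2) involution_iff_symmetric[OF iso] by simp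
    then obtain v u where v: "v \<in> Mov f" "wall_form Q f v v > 0"
      and u: "u \<in> X.orth v" "wall_form Q f u u > 0" and not_sym: "\<not> X.symmetric_on (X.orth v)"
      using X.nonsymmetric_reduction[of p] Suc.prems 3 Suc.hyps(2) self by auto
    then have pos: "Q v > 0" "Q u > 0" using self X.orth_subset by (metis, metis subsetD)
    then have ne: "Q v \<noteq> 0" by simp
    let ?g = "reflection scale Q v \<circ> f"
    have "\<not> involution ?g" using not_sym involution_reflection_comp[OF iso v(1) ne] by simp
    moreover have "u \<in> Mov ?g" using u Mov_reflection_comp(2)[OF iso v(1) ne] by simp
    ultimately have "product_of_positive_reflections scale Q (dim (Mov ?g)) ?g"
      using Suc.hyps(1)[of ?g u] dim_g[OF v(1) pos(1)] pos_g[OF v(1) pos(1)] pos(2) by simp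
    then show ?thesis using dim_g[OF v(1) pos(1)] pos v by (intro step[of v]) simp_all
  qed
qed

section \<open>Factorizations with two additional reflections\<close>

lemma product_add_2_by_reflection:
  assumes f: "f \<in> positive_isometries scale Q" and v: "v \<notin> Mov f" "Q v > 0"
    and not_inv: "\<not> involution (reflection scale Q v \<circ> f)"
  shows "product_of_positive_reflections scale Q (dim (Mov f) + 2) f"
proof -
  let ?g = "reflection scale Q v \<circ> f"
  have iso: "f \<in> isometries scale Q" using f by (simp add: positive_isometries_def)
  have "Q v \<noteq> 0" using v by simp
  note g = Mov_reflection_comp_new[OF iso v(1) this]
  have "?g \<in> positive_isometries scale Q"
    using positive_isometry_reflection_comp[OF g(1,2) v(2)] f g(3) by simp
  then have "product_of_positive_reflections scale Q (dim (Mov f) + 1) ?g"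
    using product_if_not_involution[OF _ not_inv g(2) v(2)] g(4) by simp
  then show ?thesis using product_of_positive_reflections_Suc v(2) by auto
qed

text \<open>Since \<open>v\<close> lies in the moved space of the new isometry and reflecting again
  gives back \<open>f\<close>, an involution there would make \<open>f\<close> an
  involution.\<close>

lemma product_add_2_if_not_involution:
  assumes f: "f \<in> positive_isometries scale Q" and v: "v \<notin> Mov f" "Q v > 0" and "\<not> involution f"
  shows "product_of_positive_reflections scale Q (dim (Mov f) + 2) f"
proof (rule product_add_2_by_reflection[OF f v])
  have iso: "f \<in> isometries scale Q" using f by (simp add: positive_isometries_def)
  have "Q v \<noteq> 0" using v by simp
  note g = Mov_reflection_comp_new[OF iso v(1) this]
  show "\<not> involution (reflection scale Q v \<circ> f)"
    using involution_reflection_compI[OF g(1,2)] g(3) v(2) assms(4) by auto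
qed

lemma diff_neq_add:
  fixes x y :: 'v
  assumes "y \<noteq> 0"
  shows "x - y \<noteq> x + y"
proof
  assume "x - y = x + y"
  moreover have "y + y = (x + y) - (x - y)" by simp
  ultimately have "y + y = 0" by simp
  then have "scale 2 y = 0" by (metis one_add_one scale_left_distrib scale_one)
  then show False using assms scale_eq_0_iff[of 2 y] by simp
qed

text \<open>It suffices to find a positive \<open>v\<close> that is neither negated nor fixed: the
  former keeps it outside \<open>Mov f\<close>, where \<open>f\<close> is negation, and the latter
  prevents the new isometry from being an involution.\<close>

lemma product_add_2_if_fixed_vector:
  assumes f: "f \<in> positive_isometries scale Q" and inv: "involution f" and "f \<noteq> id"
    and z: "f z = z" "z \<noteq> 0" and p: "Q p > 0"
  shows "product_of_positive_reflections scale Q (dim (Mov f) + 2) f"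
proof -
  have iso: "f \<in> isometries scale Q" using f by (simp add: positive_isometries_def)
  note isoD = isometryD[OF iso] and neg = involution_Mov[OF iso inv]
  obtain v where v: "Q v > 0" "f v \<noteq> v" "f v \<noteq> - v"
  proof (cases "f p \<noteq> p \<and> f p \<noteq> - p")
    case False
    \<comment> \<open>A fixed \<open>p\<close> is perturbed by a vector of \<open>Mov f\<close>,
      which \<open>f\<close> negates; a negated \<open>p\<close> is perturbed by the fixed vector
      \<open>z\<close>.\<close>
    have perturb: "\<exists>t\<noteq>0. Q (p + scale t x) > 0" for x
    proof -
      obtain t where "t > 0" "Q p + t * polar Q p x + t^2 * Q x > 0"
        using quadratic_positive_near_0[OF p] by blast
      then show ?thesis by (intro exI[of _ t]) (simp add: Q_add Q_scale polar_scale algebra_simps)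
    qed
    have p0: "p \<noteq> 0" using p by auto
    show ?thesis
    proof (cases "f p = p")
      case True
      obtain m where m: "m \<in> Mov f" "m \<noteq> 0"
        using \<open>f \<noteq> id\<close> Mov_trivial[of f] by (metis dim_positive_obtains_nonzero not_gr_zero)
      obtain t where t: "t \<noteq> 0" "Q (p + scale t m) > 0" using perturb by blast
      have fv: "f (p + scale t m) = p - scale t m"
        by (simp add: isoD True neg[OF m(1)])
      show ?thesis
      proof (rule that[OF t(2)])
        show "f (p + scale t m) \<noteq> p + scale t m"
          using diff_neq_add[of "scale t m" p] t(1) m(2) by (simp add: fv)
        show "f (p + scale t m) \<noteq> - (p + scale t m)"
          using diff_neq_add[OF p0, of "scale t m"] unfolding fv
          by (metis add.commute minus_diff_eq neg_equal_iff_equal)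
      qed
    next
      case False
      with \<open>\<not> (f p \<noteq> p \<and> f p \<noteq> - p)\<close> have fp: "f p = - p" by simp
      obtain t where t: "t \<noteq> 0" "Q (p + scale t z) > 0" using perturb by blast
      have fv: "f (p + scale t z) = scale t z - p"
        by (simp add: isoD fp z(1))
      show ?thesis
      proof (rule that[OF t(2)])
        show "f (p + scale t z) \<noteq> p + scale t z"
          using diff_neq_add[OF p0, of "scale t z"] by (simp add: fv add.commute)
        show "f (p + scale t z) \<noteq> - (p + scale t z)"
          using diff_neq_add[of "scale t z" p] t(1) z(2) unfolding fv
          by (metis minus_diff_eq neg_equal_iff_equal scale_eq_0_iff)
      qed
    qed
  qed (use p in blast)
  have v_Mov: "v \<notin> Mov f" using neg v(3) by blast
  have ne: "Q v \<noteq> 0" using v by simp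
  let ?g = "reflection scale Q v \<circ> f"
  note g = Mov_reflection_comp_new[OF iso v_Mov ne]
  have "\<not> involution ?g"
  proof
    assume "involution ?g"
    from involution_Mov[OF g(1) this g(2)] have "reflection scale Q v (f v) = - v" by simp
    then have "f v = reflection scale Q v (- v)" using reflection_reflection[of v "f v"] ne by simp
    also have "\<dots> = v" by (rule reflection_minus_self[OF ne])
    finally show False using v by simp
  qed
  then show ?thesis by (rule product_add_2_by_reflection[OF f v_Mov v(1)])
qed

text \<open>Without non-zero fixed vectors \<open>p + f p\<close> must vanish. Reflecting in
  \<open>p\<close> then gives an involution fixing \<open>p\<close> with moved space one dimension
  smaller, which is a product of \<open>dim (Mov f) + 1\<close> positive reflections.\<close>

lemma product_add_2_if_involution:
  assumes f: "f \<in> positive_isometries scale Q" and inv: "involution f"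
    and not_pd: "\<not> positive_definite Q (Mov f)" and p: "Q p > 0"
  shows "product_of_positive_reflections scale Q (dim (Mov f) + 2) f"
proof (cases "\<exists>z. z \<noteq> 0 \<and> f z = z")
  case True
  have "f \<noteq> id" using not_pd by (auto simp: positive_definite_def Mov_def)
  with True show ?thesis using product_add_2_if_fixed_vector[OF f inv _ _ _ p] by blast
next
  case False
  have iso: "f \<in> isometries scale Q" using f by (simp add: positive_isometries_def)
  have "f (p + f p) = p + f p"
    using inv by (simp add: isometry_add[OF iso] involution_def fun_eq_iff add.commute)
  with False have fp: "f p = - p" by (metis add.commute eq_neg_iff_add_eq_0)
  have "scale (1/2) (p + p) \<in> Mov f"
    using subspace_scale[OF subspace_Mov[OF iso] MovI[of p f]] by (simp add: fp)
  then have pM: "p \<in> Mov f" by (simp add: scale_right_distrib scale_left_distrib[symmetric])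
  have ne: "Q p \<noteq> 0" using p by simp
  let ?g = "reflection scale Q p \<circ> f"
  note g = Mov_reflection_comp[OF iso pM ne]
  have not_pd_g: "\<not> positive_definite Q (Mov ?g)"
    using positive_definite_Mov_extend[OF iso pM p inv] not_pd by blast
  have "?g p = p" by (simp add: fp reflection_minus_self[OF ne])
  moreover have "?g \<noteq> id"
  proof
    assume "?g = id"
    with not_pd_g show False by (simp add: positive_definite_def Mov_def)
  qed
  moreover have "p \<noteq> 0" using p by auto
  ultimately have "product_of_positive_reflections scale Q (dim (Mov ?g) + 2) ?g"
    using product_add_2_if_fixed_vector[of ?g p p] involution_reflection_compI[OF iso pM ne inv]
      positive_isometry_reflection_comp[OF iso pM p] f p by simp
  then show ?thesis using g(4) p product_of_positive_reflections_Suc by auto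
qed

section \<open>Lower bounds and parity\<close>

lemma product_dim_Mov:
  assumes "product_of_positive_reflections scale Q k f"
  shows "f \<in> isometries scale Q" "dim (Mov f) \<le> k" "even (dim (Mov f) + k)"
proof -
  have "f \<in> isometries scale Q \<and> dim (Mov f) \<le> k \<and> even (dim (Mov f) + k)"
    using assms
  proof (induction k arbitrary: f)
    case 0
    then have f: "f = id" by (simp add: product_of_positive_reflections_0)
    have "id \<in> isometries scale Q" by (simp add: isometries_def linear_id)
    then have "f \<in> isometries scale Q" by (simp only: f)
    moreover have "dim (Mov f) = 0" using f by (simp only: Mov_trivial)
    ultimately show ?case by (simp del: dim_eq_0)
  next
    case (Suc k)
    then obtain v where v: "Q v > 0"
      and g: "product_of_positive_reflections scale Q k (reflection scale Q v \<circ> f)"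
      by (auto simp: product_of_positive_reflections_Suc)
    let ?g = "reflection scale Q v \<circ> f"
    note IH = Suc.IH[OF g]
    have ne: "Q v \<noteq> 0" using v by simp
    then have f: "f = reflection scale Q v \<circ> ?g" by (simp add: reflection_comp_reflection)
    have iso: "f \<in> isometries scale Q"
      using IH isometries_comp[OF reflection_isometry[OF ne]] by (subst f) blast
    show ?case
    proof (cases "v \<in> Mov f")
      case True
      then show ?thesis using Mov_reflection_comp(4)[OF iso True ne] IH iso by (simp add: comp_def)
    next
      case False
      then show ?thesis using Mov_reflection_comp_new(4)[OF iso False ne] IH iso by (auto simp: comp_def)
    qed
  qed
  then show "f \<in> isometries scale Q" "dim (Mov f) \<le> k" "even (dim (Mov f) + k)" by auto
qed

text \<open>If \<open>v\<close> were outside \<open>Mov f\<close>, the remaining \<open>k\<close>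
  factors would have a moved space of dimension \<open>k + 2\<close>.\<close>

lemma product_dim_Mov_Suc:
  assumes "product_of_positive_reflections scale Q (Suc k) f" "dim (Mov f) = Suc k"
  obtains v where "v \<in> Mov f" "Q v > 0"
    "product_of_positive_reflections scale Q k (reflection scale Q v \<circ> f)"
    "dim (Mov (reflection scale Q v \<circ> f)) = k"
proof -
  obtain v where v: "Q v > 0"
    and g: "product_of_positive_reflections scale Q k (reflection scale Q v \<circ> f)"
    using assms(1) by (auto simp: product_of_positive_reflections_Suc)
  have iso: "f \<in> isometries scale Q" using product_dim_Mov(1)[OF assms(1)] .
  have ne: "Q v \<noteq> 0" using v by simp
  have "v \<in> Mov f"
    using Mov_reflection_comp_new(4)[OF iso _ ne] product_dim_Mov(2)[OF g] assms(2) by fastforce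
  moreover from this have "dim (Mov (reflection scale Q v \<circ> f)) = k"
    using Mov_reflection_comp(4)[OF iso _ ne] assms(2) by simp
  ultimately show ?thesis using that v g by blast
qed

lemma positive_definite_if_minimal_product:
  assumes "product_of_positive_reflections scale Q k f" "dim (Mov f) = k" "involution f"
  shows "positive_definite Q (Mov f)"
  using assms
proof (induction k arbitrary: f)
  case 0
  then have "Mov f = {0}" by (auto simp: product_of_positive_reflections_0 Mov_def)
  then show ?case by (simp add: positive_definite_def)
next
  case (Suc k)
  have iso: "f \<in> isometries scale Q" using product_dim_Mov(1)[OF Suc.prems(1)] .
  obtain v where v: "v \<in> Mov f" "Q v > 0"
    "product_of_positive_reflections scale Q k (reflection scale Q v \<circ> f)"
    "dim (Mov (reflection scale Q v \<circ> f)) = k"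
    using product_dim_Mov_Suc[OF Suc.prems(1,2)] .
  have "involution (reflection scale Q v \<circ> f)"
    using involution_reflection_compI[OF iso v(1) _ Suc.prems(3)] v(2) by simp
  then show ?case using positive_definite_Mov_extend[OF iso v(1,2) Suc.prems(3)] Suc.IH v by blast
qed

lemma positive_vector_exists:
  assumes "\<not> negative_definite Q UNIV"
  obtains p where "Q p > 0"
proof -
  obtain u where u: "u \<noteq> 0" "Q u \<ge> 0" using assms by (auto simp: negative_definite_def not_less)
  show ?thesis
  proof (cases "Q u = 0")
    case True
    obtain w where w: "polar Q u w \<noteq> 0" using nondegenerate[of u] u(1) by blast
    \<comment> \<open>As \<open>u\<close> is isotropic, \<open>Q (scale a u + w)\<close> is affine
      in \<open>a\<close> with non-zero slope; this \<open>a\<close> makes it 1.\<close>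
    define a where "a = (1 - Q w) / polar Q u w"
    have "Q (scale a u + w) = 1"
      using w True by (simp add: Q_add Q_scale polar_scale a_def)
    then show ?thesis using that[of "scale a u + w"] by simp
  qed (use u that[of u] in simp)
qed

theorem positive_reflection_length_eq:
  assumes "\<not> negative_definite Q UNIV" and f: "f \<in> positive_isometries scale Q" "f \<noteq> id"
  shows "positive_reflection_length scale Q f =
    (if positive_definite Q (Mov f) \<or> (\<not> involution f \<and> \<not> negative_semidefinite Q (Mov f))
     then enat (dim (Mov f)) else enat (dim (Mov f) + 2))"
proof -
  obtain p where p: "Q p > 0" using positive_vector_exists[OF assms(1)] .
  have iso: "f \<in> isometries scale Q" using f by (simp add: positive_isometries_def)
  let ?P = "\<lambda>k. product_of_positive_reflections scale Q k f"
  have lengthI: "positive_reflection_length scale Q f = enat n"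
    if "?P n" "\<And>k. ?P k \<Longrightarrow> n \<le> k" for n
    unfolding positive_reflection_length_def using that
    by (intro antisym INF_lower INF_greatest) auto
  show ?thesis
  proof (cases "positive_definite Q (Mov f) \<or> (\<not> involution f \<and> \<not> negative_semidefinite Q (Mov f))")
    case True
    then have "?P (dim (Mov f))"
      using product_if_positive_definite[OF iso] product_if_not_involution[OF f(1)]
      by (auto simp: negative_semidefinite_def not_le)
    then show ?thesis using True product_dim_Mov(2) by (simp add: lengthI)
  next
    case False
    have "?P (dim (Mov f) + 2)"
    proof (cases "involution f")
      case True
      then show ?thesis using product_add_2_if_involution[OF f(1) True _ p] False by blast
    next
      case not_inv: False
      with False have "p \<notin> Mov f" using p by (auto simp: negative_semidefinite_def not_le[symmetric])
      then show ?thesis using product_add_2_if_not_involution[OF f(1) _ p not_inv] by blast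
    qed
    moreover have "dim (Mov f) + 2 \<le> k" if k: "?P k" for k
    proof -
      have "k \<noteq> dim (Mov f)"
      proof
        assume k_eq: "k = dim (Mov f)"
        then have "k \<noteq> 0" using f(2) Mov_trivial[of f] by blast
        then obtain n where n: "k = Suc n" using not0_implies_Suc by blast
        obtain v where "v \<in> Mov f" "Q v > 0"
          using product_dim_Mov_Suc[of n f] k n k_eq by metis
        then have "\<not> negative_semidefinite Q (Mov f)" by (auto simp: negative_semidefinite_def not_le)
        moreover have "positive_definite Q (Mov f)" if "involution f"
          using positive_definite_if_minimal_product[OF k k_eq[symmetric] that] .
        ultimately show False using False by blast
      qed
      \<comment> \<open>Parity excludes \<open>dim (Mov f) + 1\<close>.\<close>
      then show ?thesis using product_dim_Mov(2,3)[OF k]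
        by (cases "k = dim (Mov f) + 1") auto
    qed
    ultimately show ?thesis using False by (simp add: lengthI)
  qed
qed

end

theorem theorem4p11:
  fixes scale :: "'a::square_dense_field \<Rightarrow> 'v::ab_group_add \<Rightarrow> 'v"
    and Basis :: "'v set"
    and Q :: "'v \<Rightarrow> 'a"
  assumes "nondegenerate_quadratic_space scale Basis Q"
    and "\<not> negative_definite Q UNIV"
  shows "(\<forall>f \<in> positive_isometries scale Q. f \<noteq> id \<longrightarrow>
            positive_reflection_length scale Q f =
              (if positive_definite Q (Mov f) \<or>
                  (\<not> involution f \<and> \<not> negative_semidefinite Q (Mov f))
               then enat (vector_space.dim scale (Mov f))
               else enat (vector_space.dim scale (Mov f) + 2)))
       \<and> (\<forall>f \<in> positive_isometries scale Q. \<exists>k. product_of_positive_reflections scale Q k f)"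
proof -
  interpret nondegenerate_quadratic_space scale Basis Q by fact
  interpret square_dense_quadratic_space scale Basis Q ..
  have length: "positive_reflection_length scale Q f =
      (if positive_definite Q (Mov f) \<or> (\<not> involution f \<and> \<not> negative_semidefinite Q (Mov f))
       then enat (dim (Mov f)) else enat (dim (Mov f) + 2))"
    if "f \<in> positive_isometries scale Q" "f \<noteq> id" for f
    using assms(2) that by (rule positive_reflection_length_eq)
  \<comment> \<open>Without a factorization the length would be \<open>\<infinity>\<close>, whereas
    the formula gives a finite value; \<open>id\<close> is the empty product.\<close>
  have "\<exists>k. product_of_positive_reflections scale Q k f" if "f \<in> positive_isometries scale Q" for f
  proof (rule ccontr)
    assume none: "\<not> ?thesis"
    then have "f \<noteq> id" using product_of_positive_reflections_0[of f] by blast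
    moreover have "positive_reflection_length scale Q f = \<infinity>"
      using none by (simp add: positive_reflection_length_def top_enat_def)
    ultimately show False using length[OF that] by (simp split: if_splits)
  qed
  with length show ?thesis by blast
qed

end
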